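(* Let $M$ be a complete pointed metric space with base point $0$. Suppose that every $x\in M$ has a neighborhood $U$ such that $\mathcal{F}(\overline{U}\cup\{0\})$ has property (V$^*$). Then $\mathcal{F}(M)$ has property (V$^*$).
   Context: For a pointed metric space $(M,d)$ with base point $0$, $\mathrm{Lip}_0(M)$ is the real Banach space of Lipschitz functions $f:M\to\mathbb{R}$ with $f(0)=0$, normed by the best Lipschitz constant $\mathrm{Lip}(f)$. For $x\in M$, $\delta(x)\in \mathrm{Lip}_0(M)^*$ is the evaluation $f\mapsto f(x)$. The Lipschitz-free space is $\mathcal{F}(M)=\overline{\mathrm{span}}\,\{\delta(x):x\in M\}\subset\mathrm{Lip}_0(M)^*$ (norm closure). For closed $N\subset M$ with $0\in N$, $\mathcal{F}(N)$ is the Lipschitz-free space over $N$ with the restricted metric and base point $0$. A series $\sum_n y_n$ in a Banach space $Y$ is weakly unconditionally Cauchy (WUC) if $\sum_n|\langle y^*,y_n\rangle|<\infty$ for every $y^*\in Y^*$. A subset $\Gamma$ of a Banach space $X$ is a (V$^*$)-set (with respect to $X$) if $\lim_{n\to\infty}\sup_{x\in\Gamma}|\langle x_n^*,x\rangle|=0$ for every WUC series $\sum_n x_n^*$ in $X^*$. $X$ has property (V$^*$) if every (V$^*$)-set with respect to $X$ is relatively weakly compact (its weak closure is weakly compact). *)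

theory Defs
  imports "HOL-Analysis.Analysis" "HOL-Library.Function_Algebras"
begin

instantiation "fun" :: (type, real_vector) real_vector
begin

definition scaleR_fun_def: "c *\<^sub>R f = (\<lambda>x. c *\<^sub>R f x)"

instance
  by standard
    (simp_all add: scaleR_fun_def fun_eq_iff scaleR_add_right scaleR_add_left)

end

lemma scaleR_fun_apply [simp]: "(c *\<^sub>R f) x = c *\<^sub>R f x"
  by (simp add: scaleR_fun_def)


text \<open>
  The free space over \<open>N\<close> depends on the set \<open>N\<close>, so it cannot be a type. A normed space is
  given here by a subspace \<open>V\<close> of an ambient real vector space together with a function
  \<open>n\<close> that is a norm on \<open>V\<close>; values of \<open>n\<close> outside \<open>V\<close> are irrelevant.
  An element of the dual is represented by the function that is \<open>0\<close> outside \<open>V\<close>, so that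
  equality of functions is equality of functionals on \<open>V\<close>.
\<close>

definition dual_carrier :: "'v::real_vector set \<Rightarrow> ('v \<Rightarrow> real) \<Rightarrow> ('v \<Rightarrow> real) set" where
  "dual_carrier V n = {\<phi>.
     (\<forall>x\<in>V. \<forall>y\<in>V. \<phi> (x + y) = \<phi> x + \<phi> y) \<and>
     (\<forall>c. \<forall>x\<in>V. \<phi> (c *\<^sub>R x) = c * \<phi> x) \<and>
     (\<exists>C. \<forall>x\<in>V. \<bar>\<phi> x\<bar> \<le> C * n x) \<and>
     (\<forall>x. x \<notin> V \<longrightarrow> \<phi> x = 0)}"

definition dual_norm :: "'v::real_vector set \<Rightarrow> ('v \<Rightarrow> real) \<Rightarrow> ('v \<Rightarrow> real) \<Rightarrow> real" where
  "dual_norm V n \<phi> = (SUP x\<in>{x \<in> V. n x \<le> 1}. \<bar>\<phi> x\<bar>)"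

definition weak_topology :: "'v::real_vector set \<Rightarrow> ('v \<Rightarrow> real) \<Rightarrow> 'v topology" where
  "weak_topology V n =
     topology_generated_by {{x \<in> V. \<phi> x \<in> S} | \<phi> S. \<phi> \<in> dual_carrier V n \<and> open S}"

definition WUC :: "'v::real_vector set \<Rightarrow> ('v \<Rightarrow> real) \<Rightarrow> (nat \<Rightarrow> 'v) \<Rightarrow> bool" where
  "WUC V n y \<longleftrightarrow> range y \<subseteq> V \<and> (\<forall>\<phi>\<in>dual_carrier V n. summable (\<lambda>k. \<bar>\<phi> (y k)\<bar>))"

text \<open>
  The supremum is taken in \<open>ennreal\<close>: it is \<open>\<infinity>\<close> for an unbounded family and
  \<open>0\<close> for the empty one, whereas the real-valued \<open>Sup\<close> is unspecified in both cases.
\<close>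

definition Vstar_set :: "'v::real_vector set \<Rightarrow> ('v \<Rightarrow> real) \<Rightarrow> 'v set \<Rightarrow> bool" where
  "Vstar_set V n \<Gamma> \<longleftrightarrow> \<Gamma> \<subseteq> V \<and>
     (\<forall>\<xi>. WUC (dual_carrier V n) (dual_norm V n) \<xi> \<longrightarrow>
          (\<lambda>k. SUP x\<in>\<Gamma>. ennreal \<bar>\<xi> k x\<bar>) \<longlonglongrightarrow> 0)"

definition property_Vstar :: "'v::real_vector set \<Rightarrow> ('v \<Rightarrow> real) \<Rightarrow> bool" where
  "property_Vstar V n \<longleftrightarrow>
     (\<forall>\<Gamma>. Vstar_set V n \<Gamma> \<longrightarrow>
          compactin (weak_topology V n) (weak_topology V n closure_of \<Gamma>))"


text \<open>
  In the following \<open>N\<close> is a subset of a metric space, with the restricted metric and base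
  point \<open>z \<in> N\<close>. Functions on \<open>N\<close> are again represented by functions that are
  \<open>0\<close> outside \<open>N\<close>.
\<close>

definition Lip0 :: "'a::metric_space set \<Rightarrow> 'a \<Rightarrow> ('a \<Rightarrow> real) set" where
  "Lip0 N z = {f. f z = 0 \<and> (\<exists>L. L-lipschitz_on N f) \<and> (\<forall>x. x \<notin> N \<longrightarrow> f x = 0)}"

definition Lip_const :: "'a::metric_space set \<Rightarrow> ('a \<Rightarrow> real) \<Rightarrow> real" where
  "Lip_const N f = Inf {L. L-lipschitz_on N f}"

definition delta :: "'a::metric_space set \<Rightarrow> 'a \<Rightarrow> 'a \<Rightarrow> ('a \<Rightarrow> real) \<Rightarrow> real" where
  "delta N z x = (\<lambda>f. if f \<in> Lip0 N z then f x else 0)"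

definition free_norm :: "'a::metric_space set \<Rightarrow> 'a \<Rightarrow> (('a \<Rightarrow> real) \<Rightarrow> real) \<Rightarrow> real" where
  "free_norm N z = dual_norm (Lip0 N z) (Lip_const N)"

definition free_space :: "'a::metric_space set \<Rightarrow> 'a \<Rightarrow> (('a \<Rightarrow> real) \<Rightarrow> real) set" where
  "free_space N z = {\<mu> \<in> dual_carrier (Lip0 N z) (Lip_const N).
     \<forall>e>0. \<exists>\<nu>\<in>span (delta N z ` N). free_norm N z (\<mu> - \<nu>) < e}"

end

theory Submission
  imports Defs
begin

text \<open>
  Write \<open>F(N)\<close> for the free space over \<open>N\<close>. Its dual is \<open>Lip0 N z\<close>, acting by evaluation, so its weak
  topology is pointwise convergence of functions on \<open>Lip0 N z\<close> (\<open>weak_topology_free_space\<close>). A (V*)-set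
  \<open>\<Gamma>\<close> is pointwise bounded, hence its pointwise closure among all functions on \<open>Lip0\<close> is compact by
  Tychonoff's theorem. It remains to show that every \<open>\<theta>\<close> in this closure belongs to the free space \<open>F(M)\<close>
  over the whole space \<open>M\<close>.

  A suitable function \<open>h\<close> acts on functionals by \<open>\<mu> \<mapsto> (f \<mapsto> \<mu> (h * f))\<close>. These operators map free
  spaces to free spaces, map (V*)-sets to (V*)-sets and are continuous for pointwise convergence.
  If \<open>h\<close> is supported in a neighbourhood \<open>U\<close> for which \<open>F(closure U \<union> {z})\<close> has property (V*), then
  \<open>h\<close> maps \<open>\<Gamma>\<close> to a (V*)-set of that space, and therefore \<open>\<theta>\<close> to an element of it
  (\<open>localized_limit_in_free_space\<close>). A partition of unity extends this to every \<open>h\<close> supported in a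
  finite union of such neighbourhoods (\<open>patch_localized_limits\<close>).

  So it suffices to approximate \<open>\<Gamma>\<close> uniformly by its image under such an \<open>h\<close>. Uniformly
  Lipschitz functions with disjoint supports form a WUC series, on which a (V*)-set is uniformly
  small. A gliding hump argument of Kalton then shows that \<open>\<Gamma>\<close> is concentrated, up to any given
  error, on a neighbourhood of prescribed relative size of a finite set
  (\<open>Vstar_set_concentrated\<close>). Iterating this with sizes tending to \<open>0\<close> makes the supports shrink, by
  completeness of \<open>M\<close>, towards a compact set. After finitely many steps they lie in finitely many of
  the given neighbourhoods (\<open>Vstar_set_tight\<close>). Then \<open>\<theta>\<close> is a limit in norm of elements of
  \<open>F(M)\<close>, and \<open>F(M)\<close> is norm closed.
\<close>

section \<open>Duals and bounded operators\<close>

text \<open>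
  Instances are \<open>Lip0\<close> with the Lipschitz constant, the free space with its norm, and the dual of
  every instance. One set of facts about bounded functionals thus serves the free space, its dual
  and its bidual.
\<close>

locale gauged_subspace =
  fixes V :: "'v::real_vector set" and n :: "'v \<Rightarrow> real"
  assumes subspace: "subspace V"
    and gauge_nonneg: "x \<in> V \<Longrightarrow> 0 \<le> n x"
    and gauge_scaleR: "x \<in> V \<Longrightarrow> n (c *\<^sub>R x) = \<bar>c\<bar> * n x"

lemma dual_carrierD:
  assumes "\<phi> \<in> dual_carrier V n"
  shows dual_add: "x \<in> V \<Longrightarrow> y \<in> V \<Longrightarrow> \<phi> (x + y) = \<phi> x + \<phi> y"
    and dual_scaleR: "x \<in> V \<Longrightarrow> \<phi> (c *\<^sub>R x) = c * \<phi> x"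
    and dual_outside: "x \<notin> V \<Longrightarrow> \<phi> x = 0"
  using assms by (auto simp: dual_carrier_def)

lemma dual_carrierI:
  assumes "\<And>x y. x \<in> V \<Longrightarrow> y \<in> V \<Longrightarrow> \<phi> (x + y) = \<phi> x + \<phi> y"
    and "\<And>c x. x \<in> V \<Longrightarrow> \<phi> (c *\<^sub>R x) = c * \<phi> x"
    and "\<And>x. x \<in> V \<Longrightarrow> \<bar>\<phi> x\<bar> \<le> C * n x"
    and "\<And>x. x \<notin> V \<Longrightarrow> \<phi> x = 0"
  shows "\<phi> \<in> dual_carrier V n"
  using assms unfolding dual_carrier_def by blast

context gauged_subspace
begin

lemma dual_bounded:
  assumes "\<phi> \<in> dual_carrier V n"
  obtains C where "0 \<le> C" "\<And>x. x \<in> V \<Longrightarrow> \<bar>\<phi> x\<bar> \<le> C * n x"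
proof -
  obtain C where C: "\<forall>x\<in>V. \<bar>\<phi> x\<bar> \<le> C * n x"
    using assms unfolding dual_carrier_def by blast
  show ?thesis
  proof (rule that[of "\<bar>C\<bar>"])
    fix x assume "x \<in> V"
    then have "C * n x \<le> \<bar>C\<bar> * n x"
      by (intro mult_right_mono) (auto simp: gauge_nonneg)
    with C \<open>x \<in> V\<close> show "\<bar>\<phi> x\<bar> \<le> \<bar>C\<bar> * n x" by force
  qed simp
qed

lemma dual_zero: "\<phi> \<in> dual_carrier V n \<Longrightarrow> \<phi> 0 = 0"
  using dual_scaleR[of \<phi> V n 0 0] subspace_0[OF subspace] by simp

lemma gauge_zero: "n 0 = 0"
  using gauge_scaleR[of 0 0] subspace_0[OF subspace] by simp

lemma dual_diff:
  assumes "\<phi> \<in> dual_carrier V n" "x \<in> V" "y \<in> V"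
  shows "\<phi> (x - y) = \<phi> x - \<phi> y"
proof -
  have "x - y = x + (-1) *\<^sub>R y" by simp
  then show ?thesis
    using dual_add[OF assms(1,2), of "(-1) *\<^sub>R y"] dual_scaleR[OF assms(1,3), of "-1"]
      subspace_scale[OF subspace assms(3), of "-1"] by simp
qed

lemma dual_sum:
  assumes "\<phi> \<in> dual_carrier V n" "finite A" "\<And>k. k \<in> A \<Longrightarrow> x k \<in> V"
  shows "\<phi> (\<Sum>k\<in>A. s k *\<^sub>R x k) = (\<Sum>k\<in>A. s k * \<phi> (x k))"
  using assms(2,3)
proof (induction A rule: finite_induct)
  case empty
  then show ?case using dual_zero[OF assms(1)] by simp
next
  case (insert a A)
  have "(\<Sum>k\<in>A. s k *\<^sub>R x k) \<in> V"
    using insert by (intro subspace_sum[OF subspace] subspace_scale[OF subspace]) auto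
  moreover have "s a *\<^sub>R x a \<in> V"
    using insert by (intro subspace_scale[OF subspace]) auto
  ultimately show ?case
    using insert by (simp add: dual_add[OF assms(1)] dual_scaleR[OF assms(1)])
qed

lemma dual_bdd_above:
  assumes "\<phi> \<in> dual_carrier V n"
  shows "bdd_above ((\<lambda>x. \<bar>\<phi> x\<bar>) ` {x \<in> V. n x \<le> 1})"
proof -
  obtain C where C: "0 \<le> C" "\<And>x. x \<in> V \<Longrightarrow> \<bar>\<phi> x\<bar> \<le> C * n x"
    using dual_bounded[OF assms] by blast
  show ?thesis
  proof (rule bdd_aboveI2)
    fix x assume x: "x \<in> {x \<in> V. n x \<le> 1}"
    then have "C * n x \<le> C * 1" using C(1) by (intro mult_left_mono) auto
    then show "\<bar>\<phi> x\<bar> \<le> C" using C(2)[of x] x by simp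
  qed
qed

lemma dual_norm_nonneg:
  assumes "\<phi> \<in> dual_carrier V n"
  shows "0 \<le> dual_norm V n \<phi>"
proof -
  have "\<bar>\<phi> 0\<bar> \<le> dual_norm V n \<phi>"
    unfolding dual_norm_def
    by (rule cSUP_upper[OF _ dual_bdd_above[OF assms]])
       (simp add: subspace_0[OF subspace] gauge_zero)
  then show ?thesis by linarith
qed

lemma dual_norm_bound:
  assumes "\<phi> \<in> dual_carrier V n" "x \<in> V"
  shows "\<bar>\<phi> x\<bar> \<le> dual_norm V n \<phi> * n x"
proof (cases "n x = 0")
  case True
  obtain C where "\<bar>\<phi> x\<bar> \<le> C * n x" using dual_bounded[OF assms(1)] assms(2) by metis
  then show ?thesis using True by simp
next
  case False
  then have pos: "n x > 0" using gauge_nonneg[OF assms(2)] by simp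
  let ?y = "(1 / n x) *\<^sub>R x"
  have "?y \<in> V" by (rule subspace_scale[OF subspace assms(2)])
  moreover have "n ?y = 1" using pos by (simp add: gauge_scaleR[OF assms(2)])
  ultimately have "\<bar>\<phi> ?y\<bar> \<le> dual_norm V n \<phi>"
    unfolding dual_norm_def by (intro cSUP_upper[OF _ dual_bdd_above[OF assms(1)]]) simp
  then show ?thesis
    using pos by (simp add: dual_scaleR[OF assms] abs_mult field_simps)
qed

lemma dual_norm_le:
  assumes "\<And>x. x \<in> V \<Longrightarrow> n x \<le> 1 \<Longrightarrow> \<bar>\<phi> x\<bar> \<le> c"
  shows "dual_norm V n \<phi> \<le> c"
  unfolding dual_norm_def
  using assms subspace_0[OF subspace] gauge_zero
  by (intro cSUP_least) (auto intro: exI[of _ 0])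

lemma subspace_dual: "subspace (dual_carrier V n)"
proof (rule subspaceI)
  show "0 \<in> dual_carrier V n"
    by (rule dual_carrierI[where C = 0]) auto
next
  fix \<phi> \<psi> assume *: "\<phi> \<in> dual_carrier V n" "\<psi> \<in> dual_carrier V n"
  obtain C D where CD: "\<And>x. x \<in> V \<Longrightarrow> \<bar>\<phi> x\<bar> \<le> C * n x" "\<And>x. x \<in> V \<Longrightarrow> \<bar>\<psi> x\<bar> \<le> D * n x"
    using dual_bounded[OF *(1)] dual_bounded[OF *(2)] by metis
  show "\<phi> + \<psi> \<in> dual_carrier V n"
  proof (rule dual_carrierI[where C = "C + D"])
    fix x assume "x \<in> V"
    from CD(1)[OF this] CD(2)[OF this] show "\<bar>(\<phi> + \<psi>) x\<bar> \<le> (C + D) * n x"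
      by (simp add: algebra_simps)
  qed (auto simp: dual_carrierD[OF *(1)] dual_carrierD[OF *(2)] algebra_simps)
next
  fix c \<phi> assume *: "\<phi> \<in> dual_carrier V n"
  obtain C where C: "\<And>x. x \<in> V \<Longrightarrow> \<bar>\<phi> x\<bar> \<le> C * n x"
    using dual_bounded[OF *] by metis
  show "c *\<^sub>R \<phi> \<in> dual_carrier V n"
  proof (rule dual_carrierI[where C = "\<bar>c\<bar> * C"])
    fix x assume "x \<in> V"
    from mult_left_mono[OF C[OF this], of "\<bar>c\<bar>"]
    show "\<bar>(c *\<^sub>R \<phi>) x\<bar> \<le> \<bar>c\<bar> * C * n x"
      by (simp add: abs_mult algebra_simps)
  qed (auto simp: dual_carrierD[OF *] algebra_simps)
qed

lemma dual_norm_scaleR: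
  assumes "\<phi> \<in> dual_carrier V n"
  shows "dual_norm V n (c *\<^sub>R \<phi>) = \<bar>c\<bar> * dual_norm V n \<phi>"
proof -
  have le: "dual_norm V n (b *\<^sub>R \<psi>) \<le> \<bar>b\<bar> * dual_norm V n \<psi>" if "\<psi> \<in> dual_carrier V n" for b \<psi>
  proof (rule dual_norm_le)
    fix x assume "x \<in> V" "n x \<le> 1"
    then have "\<bar>\<psi> x\<bar> \<le> dual_norm V n \<psi> * 1"
      by (meson dual_norm_bound[OF that] dual_norm_nonneg[OF that] mult_left_mono order_trans)
    then show "\<bar>(b *\<^sub>R \<psi>) x\<bar> \<le> \<bar>b\<bar> * dual_norm V n \<psi>"
      by (simp add: abs_mult mult_left_mono)
  qed
  show ?thesis
  proof (cases "c = 0")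
    case True
    then show ?thesis
      using le[OF assms, of 0] dual_norm_nonneg[OF subspace_scale[OF subspace_dual assms], of 0]
      by simp
  next
    case False
    have "dual_norm V n \<phi> = dual_norm V n ((1 / c) *\<^sub>R (c *\<^sub>R \<phi>))"
      using False by simp
    also have "\<dots> \<le> \<bar>1 / c\<bar> * dual_norm V n (c *\<^sub>R \<phi>)"
      by (rule le) (rule subspace_scale[OF subspace_dual assms])
    finally have "\<bar>c\<bar> * dual_norm V n \<phi> \<le> dual_norm V n (c *\<^sub>R \<phi>)"
      using False by (simp add: field_simps)
    then show ?thesis using le[OF assms, of c] by linarith
  qed
qed

lemma gauged_dual: "gauged_subspace (dual_carrier V n) (dual_norm V n)"
  by unfold_locales (auto simp: subspace_dual dual_norm_nonneg dual_norm_scaleR)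

text \<open>
  For a bounded functional \<open>\<phi>\<close>, choosing \<open>s k\<close> as the sign of \<open>\<phi> (y k)\<close> turns the partial sums of
  \<open>\<bar>\<phi> (y k)\<bar>\<close> into values of \<open>\<phi>\<close> at signed sums.
\<close>

lemma WUC_if_bounded_signed_sums:
  assumes V: "range y \<subseteq> V"
    and bound: "\<And>m s. (\<And>k. \<bar>s k\<bar> \<le> 1) \<Longrightarrow> n (\<Sum>k<m. s k *\<^sub>R y k) \<le> C"
  shows "WUC V n y"
  unfolding WUC_def
proof (intro conjI ballI V)
  fix \<phi> assume \<phi>: "\<phi> \<in> dual_carrier V n"
  obtain B where B: "0 \<le> B" "\<And>x. x \<in> V \<Longrightarrow> \<bar>\<phi> x\<bar> \<le> B * n x"
    using dual_bounded[OF \<phi>] by blast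
  show "summable (\<lambda>k. \<bar>\<phi> (y k)\<bar>)"
  proof (rule summableI_nonneg_bounded)
    fix m
    define s where "s k = sgn (\<phi> (y k))" for k
    have "(\<Sum>k<m. \<bar>\<phi> (y k)\<bar>) = (\<Sum>k<m. s k * \<phi> (y k))"
      by (intro sum.cong) (auto simp: s_def abs_sgn mult.commute)
    also have "\<dots> = \<phi> (\<Sum>k<m. s k *\<^sub>R y k)"
      using V by (intro dual_sum[OF \<phi>, symmetric]) auto
    also have "\<dots> \<le> B * n (\<Sum>k<m. s k *\<^sub>R y k)"
    proof -
      have "(\<Sum>k<m. s k *\<^sub>R y k) \<in> V"
        using V by (intro subspace_sum[OF subspace] subspace_scale[OF subspace]) auto
      from B(2)[OF this] show ?thesis by linarith
    qed
    also have "\<dots> \<le> B * C"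
      by (intro mult_left_mono bound B(1)) (auto simp: s_def sgn_real_def)
    finally show "(\<Sum>k<m. \<bar>\<phi> (y k)\<bar>) \<le> B * C" .
  qed simp
qed

end

text \<open>
  A bounded operator \<open>T\<close> maps (V*)-sets to (V*)-sets: the adjoint \<open>\<eta> \<mapsto> \<eta> \<circ> T\<close> is bounded, hence
  maps WUC series to WUC series, and \<open>\<eta> (T \<mu>)\<close> is the value of \<open>\<eta> \<circ> T\<close> at \<open>\<mu>\<close>.
\<close>

lemma Vstar_set_image:
  fixes V :: "'v::real_vector set" and V' :: "'w::real_vector set"
  assumes "gauged_subspace V n" "gauged_subspace V' n'"
    and T: "T ` V \<subseteq> V'"
    and Tadd: "\<And>x y. x \<in> V \<Longrightarrow> y \<in> V \<Longrightarrow> T (x + y) = T x + T y"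
    and Tscale: "\<And>c x. x \<in> V \<Longrightarrow> T (c *\<^sub>R x) = c *\<^sub>R T x"
    and Tbound: "\<And>x. x \<in> V \<Longrightarrow> n' (T x) \<le> K * n x"
    and \<Gamma>: "Vstar_set V n \<Gamma>"
  shows "Vstar_set V' n' (T ` \<Gamma>)"
proof -
  interpret V: gauged_subspace V n by fact
  interpret V': gauged_subspace V' n' by fact
  define adj where "adj \<eta> = (\<lambda>x. if x \<in> V then \<eta> (T x) else 0)" for \<eta> :: "'w \<Rightarrow> real"
  have bound: "\<bar>adj \<eta> x\<bar> \<le> (dual_norm V' n' \<eta> * \<bar>K\<bar>) * n x"
    if \<eta>: "\<eta> \<in> dual_carrier V' n'" and x: "x \<in> V" for \<eta> x
  proof -
    have "\<bar>\<eta> (T x)\<bar> \<le> dual_norm V' n' \<eta> * n' (T x)"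
      using V'.dual_norm_bound[OF \<eta>] T x by blast
    also have "\<dots> \<le> dual_norm V' n' \<eta> * (\<bar>K\<bar> * n x)"
    proof (rule mult_left_mono)
      have "K * n x \<le> \<bar>K\<bar> * n x"
        by (intro mult_right_mono) (auto simp: V.gauge_nonneg[OF x])
      then show "n' (T x) \<le> \<bar>K\<bar> * n x" using Tbound[OF x] by linarith
    qed (rule V'.dual_norm_nonneg[OF \<eta>])
    finally show ?thesis using x by (simp add: adj_def mult.assoc)
  qed
  have adj: "adj \<eta> \<in> dual_carrier V n" if \<eta>: "\<eta> \<in> dual_carrier V' n'" for \<eta>
  proof (rule dual_carrierI[where C = "dual_norm V' n' \<eta> * \<bar>K\<bar>"])
    show "\<bar>adj \<eta> x\<bar> \<le> dual_norm V' n' \<eta> * \<bar>K\<bar> * n x" if "x \<in> V" for x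
      using bound[OF \<eta> that] .
  qed (use T in \<open>auto simp: adj_def Tadd Tscale subspace_add[OF V.subspace] subspace_scale[OF V.subspace]
        image_subset_iff dual_add[OF \<eta>] dual_scaleR[OF \<eta>]\<close>)
  have adj_norm: "dual_norm V n (adj \<eta>) \<le> \<bar>K\<bar> * dual_norm V' n' \<eta>"
    if \<eta>: "\<eta> \<in> dual_carrier V' n'" for \<eta>
  proof (rule V.dual_norm_le)
    fix x assume x: "x \<in> V" "n x \<le> 1"
    have "\<bar>adj \<eta> x\<bar> \<le> (dual_norm V' n' \<eta> * \<bar>K\<bar>) * n x" by (rule bound[OF \<eta> x(1)])
    also have "\<dots> \<le> (dual_norm V' n' \<eta> * \<bar>K\<bar>) * 1"
      by (rule mult_left_mono[OF x(2)]) (simp add: V'.dual_norm_nonneg[OF \<eta>])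
    finally show "\<bar>adj \<eta> x\<bar> \<le> \<bar>K\<bar> * dual_norm V' n' \<eta>" by (simp add: mult.commute)
  qed
  have adj_add: "adj (\<eta> + \<zeta>) = adj \<eta> + adj \<zeta>" for \<eta> \<zeta>
    by (auto simp: adj_def fun_eq_iff)
  have adj_scale: "adj (c *\<^sub>R \<eta>) = c *\<^sub>R adj \<eta>" for c \<eta>
    by (auto simp: adj_def fun_eq_iff)
  have \<Gamma>V: "\<Gamma> \<subseteq> V" using \<Gamma> by (simp add: Vstar_set_def)
  show ?thesis
    unfolding Vstar_set_def
  proof (intro conjI allI impI)
    show "T ` \<Gamma> \<subseteq> V'" using T \<Gamma>V by blast
  next
    fix \<xi> assume \<xi>: "WUC (dual_carrier V' n') (dual_norm V' n') \<xi>"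
    then have \<xi>V': "\<xi> k \<in> dual_carrier V' n'" for k by (auto simp: WUC_def)
    have "WUC (dual_carrier V n) (dual_norm V n) (\<lambda>k. adj (\<xi> k))"
      unfolding WUC_def
    proof (intro conjI ballI)
      show "range (\<lambda>k. adj (\<xi> k)) \<subseteq> dual_carrier V n" using adj \<xi>V' by blast
    next
      fix \<Phi> assume \<Phi>: "\<Phi> \<in> dual_carrier (dual_carrier V n) (dual_norm V n)"
      define \<Psi> where "\<Psi> \<eta> = (if \<eta> \<in> dual_carrier V' n' then \<Phi> (adj \<eta>) else 0)" for \<eta>
      obtain C where C: "0 \<le> C" "\<And>\<phi>. \<phi> \<in> dual_carrier V n \<Longrightarrow> \<bar>\<Phi> \<phi>\<bar> \<le> C * dual_norm V n \<phi>"
        using gauged_subspace.dual_bounded[OF V.gauged_dual \<Phi>] by blast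
      have "\<Psi> \<in> dual_carrier (dual_carrier V' n') (dual_norm V' n')"
      proof (rule dual_carrierI[where C = "C * \<bar>K\<bar>"])
        fix \<eta> assume \<eta>: "\<eta> \<in> dual_carrier V' n'"
        have "\<bar>\<Psi> \<eta>\<bar> \<le> C * dual_norm V n (adj \<eta>)"
          using \<eta> C(2)[OF adj[OF \<eta>]] by (simp add: \<Psi>_def)
        also have "\<dots> \<le> C * (\<bar>K\<bar> * dual_norm V' n' \<eta>)"
          by (rule mult_left_mono[OF adj_norm[OF \<eta>] C(1)])
        finally show "\<bar>\<Psi> \<eta>\<bar> \<le> C * \<bar>K\<bar> * dual_norm V' n' \<eta>" by (simp add: mult.assoc)
      qed (auto simp: \<Psi>_def adj adj_add adj_scale dual_add[OF \<Phi>] dual_scaleR[OF \<Phi>]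
          subspace_add[OF V'.subspace_dual] subspace_scale[OF V'.subspace_dual])
      with \<xi> have "summable (\<lambda>k. \<bar>\<Psi> (\<xi> k)\<bar>)" by (auto simp: WUC_def)
      then show "summable (\<lambda>k. \<bar>\<Phi> (adj (\<xi> k))\<bar>)" by (simp add: \<Psi>_def \<xi>V')
    qed
    with \<Gamma> have "(\<lambda>k. SUP x\<in>\<Gamma>. ennreal \<bar>adj (\<xi> k) x\<bar>) \<longlonglongrightarrow> 0"
      by (auto simp: Vstar_set_def)
    moreover have "(SUP x\<in>\<Gamma>. ennreal \<bar>adj (\<xi> k) x\<bar>) = (SUP y\<in>T ` \<Gamma>. ennreal \<bar>\<xi> k y\<bar>)" for k
      using \<Gamma>V by (auto simp: image_image adj_def subset_iff intro!: SUP_cong)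
    ultimately show "(\<lambda>k. SUP y\<in>T ` \<Gamma>. ennreal \<bar>\<xi> k y\<bar>) \<longlonglongrightarrow> 0" by simp
  qed
qed

text \<open>
  The pointwise bound and the gliding hump argument both use a single index at which \<open>\<Gamma>\<close> is
  uniformly small.
\<close>

lemma Vstar_set_small:
  assumes "Vstar_set V n \<Gamma>" "WUC (dual_carrier V n) (dual_norm V n) \<xi>" "0 < e"
  obtains k where "\<And>x. x \<in> \<Gamma> \<Longrightarrow> \<bar>\<xi> k x\<bar> \<le> e"
proof -
  have "(\<lambda>k. SUP x\<in>\<Gamma>. ennreal \<bar>\<xi> k x\<bar>) \<longlonglongrightarrow> 0"
    using assms by (auto simp: Vstar_set_def)
  then have "\<forall>\<^sub>F k in sequentially. (SUP x\<in>\<Gamma>. ennreal \<bar>\<xi> k x\<bar>) < ennreal e"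
    by (rule order_tendstoD) (use assms(3) in auto)
  then obtain k where k: "(SUP x\<in>\<Gamma>. ennreal \<bar>\<xi> k x\<bar>) < ennreal e"
    by (auto simp: eventually_sequentially)
  show ?thesis
  proof (rule that[of k])
    fix x assume "x \<in> \<Gamma>"
    then have "ennreal \<bar>\<xi> k x\<bar> \<le> (SUP x\<in>\<Gamma>. ennreal \<bar>\<xi> k x\<bar>)" by (rule SUP_upper)
    with k have "ennreal \<bar>\<xi> k x\<bar> \<le> ennreal e" by (auto intro: order_trans less_imp_le)
    then show "\<bar>\<xi> k x\<bar> \<le> e" using assms(3) by (simp add: ennreal_le_iff)
  qed
qed

section \<open>The free space and its weak topology\<close>

lemma subspace_Lip0: "subspace (Lip0 N z)"
proof (rule subspaceI)
  show "0 \<in> Lip0 N z"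
    by (auto simp: Lip0_def intro!: exI[of _ 0] lipschitz_onI)
next
  fix f g assume "f \<in> Lip0 N z" "g \<in> Lip0 N z"
  moreover from this obtain L M where "L-lipschitz_on N f" "M-lipschitz_on N g"
    by (auto simp: Lip0_def)
  then have "(L + M)-lipschitz_on N (f + g)"
    unfolding plus_fun_def by (rule lipschitz_on_add)
  ultimately show "f + g \<in> Lip0 N z" by (auto simp: Lip0_def)
next
  fix c f assume "f \<in> Lip0 N z"
  moreover from this obtain L where "L-lipschitz_on N f"
    by (auto simp: Lip0_def)
  then have "(\<bar>c\<bar> * L)-lipschitz_on N (c *\<^sub>R f)"
    unfolding scaleR_fun_def by (rule lipschitz_on_cmult)
  ultimately show "c *\<^sub>R f \<in> Lip0 N z" by (auto simp: Lip0_def)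
qed

lemma Lip_const_le: "L-lipschitz_on N f \<Longrightarrow> Lip_const N f \<le> L"
  unfolding Lip_const_def
  by (rule cInf_lower) (auto intro!: bdd_belowI[of _ 0] dest: lipschitz_on_nonneg)

lemma lipschitz_Lip_const:
  assumes "f \<in> Lip0 N z"
  shows "(Lip_const N f)-lipschitz_on N f"
proof -
  have ne: "{L. L-lipschitz_on N f} \<noteq> {}" using assms by (auto simp: Lip0_def)
  show ?thesis
  proof (rule lipschitz_onI)
    fix x y assume xy: "x \<in> N" "y \<in> N"
    show "dist (f x) (f y) \<le> Lip_const N f * dist x y"
    proof (cases "x = y")
      case False
      have "dist (f x) (f y) / dist x y \<le> Lip_const N f"
        unfolding Lip_const_def
      proof (rule cInf_greatest[OF ne])
        fix L assume "L \<in> {L. L-lipschitz_on N f}"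
        then show "dist (f x) (f y) / dist x y \<le> L"
          using False xy by (simp add: divide_le_eq lipschitz_onD)
      qed
      then show ?thesis using False by (simp add: divide_le_eq)
    qed simp
  next
    show "0 \<le> Lip_const N f"
      unfolding Lip_const_def
      by (rule cInf_greatest[OF ne]) (auto dest: lipschitz_on_nonneg)
  qed
qed

lemma Lip_const_nonneg: "f \<in> Lip0 N z \<Longrightarrow> 0 \<le> Lip_const N f"
  using lipschitz_Lip_const lipschitz_on_nonneg by blast

lemma Lip0_dist_le:
  assumes "f \<in> Lip0 N z" "x \<in> N" "y \<in> N"
  shows "\<bar>f x - f y\<bar> \<le> Lip_const N f * dist x y"
  using lipschitz_onD[OF lipschitz_Lip_const[OF assms(1)] assms(2,3)] by (simp add: dist_real_def)

lemma Lip0_abs_le: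
  assumes "f \<in> Lip0 N z" "x \<in> N" "z \<in> N"
  shows "\<bar>f x\<bar> \<le> Lip_const N f * dist x z"
  using Lip0_dist_le[OF assms] assms(1) by (simp add: Lip0_def)

lemma Lip0I:
  assumes "f z = 0" "0 \<le> L" "\<And>x y. x \<in> N \<Longrightarrow> y \<in> N \<Longrightarrow> \<bar>f x - f y\<bar> \<le> L * dist x y"
    and "\<And>x. x \<notin> N \<Longrightarrow> f x = 0"
  shows "f \<in> Lip0 N z" and "Lip_const N f \<le> L"
proof -
  have "L-lipschitz_on N f"
    using assms(2,3) by (auto intro!: lipschitz_onI simp: dist_real_def)
  then show "f \<in> Lip0 N z" "Lip_const N f \<le> L"
    using assms(1,4) by (auto simp: Lip0_def intro: Lip_const_le)
qed

lemma gauged_Lip0: "gauged_subspace (Lip0 N z) (Lip_const N)"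
proof
  have le: "Lip_const N (b *\<^sub>R g) \<le> \<bar>b\<bar> * Lip_const N g" if "g \<in> Lip0 N z" for b g
    unfolding scaleR_fun_def
    by (intro Lip_const_le lipschitz_on_cmult lipschitz_Lip_const[OF that])
  fix c f assume f: "f \<in> Lip0 N z"
  show "Lip_const N (c *\<^sub>R f) = \<bar>c\<bar> * Lip_const N f"
  proof (cases "c = 0")
    case True
    then show ?thesis
      using le[OF f, of 0] Lip_const_nonneg[OF subspace_scale[OF subspace_Lip0 f], of 0] by simp
  next
    case False
    have "Lip_const N f = Lip_const N ((1 / c) *\<^sub>R (c *\<^sub>R f))" using False by simp
    also have "\<dots> \<le> \<bar>1 / c\<bar> * Lip_const N (c *\<^sub>R f)"
      by (rule le) (rule subspace_scale[OF subspace_Lip0 f])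
    finally have "\<bar>c\<bar> * Lip_const N f \<le> Lip_const N (c *\<^sub>R f)"
      using False by (simp add: field_simps)
    then show ?thesis using le[OF f, of c] by linarith
  qed
qed (auto simp: subspace_Lip0 Lip_const_nonneg)

lemma delta_in_dual:
  assumes "z \<in> N" "x \<in> N"
  shows "delta N z x \<in> dual_carrier (Lip0 N z) (Lip_const N)"
proof (rule dual_carrierI[where C = "dist x z"])
  show "\<bar>delta N z x f\<bar> \<le> dist x z * Lip_const N f" if "f \<in> Lip0 N z" for f
    using Lip0_abs_le[OF that assms(2,1)] that by (simp add: delta_def mult.commute)
qed (auto simp: delta_def subspace_add[OF subspace_Lip0] subspace_scale[OF subspace_Lip0])

lemma span_delta_dual:
  assumes "z \<in> N"
  shows "span (delta N z ` N) \<subseteq> dual_carrier (Lip0 N z) (Lip_const N)"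
  using delta_in_dual[OF assms]
  by (intro span_minimal gauged_subspace.subspace_dual[OF gauged_Lip0]) auto

definition Lip0_functional :: "'a::metric_space set \<Rightarrow> 'a \<Rightarrow> (('a \<Rightarrow> real) \<Rightarrow> real) \<Rightarrow> bool" where
  "Lip0_functional N z \<mu> \<longleftrightarrow>
     (\<forall>f\<in>Lip0 N z. \<forall>g\<in>Lip0 N z. \<mu> (f + g) = \<mu> f + \<mu> g) \<and>
     (\<forall>c. \<forall>f\<in>Lip0 N z. \<mu> (c *\<^sub>R f) = c * \<mu> f) \<and>
     (\<forall>f. f \<notin> Lip0 N z \<longrightarrow> \<mu> f = 0)"

lemma Lip0_functional_dual:
  "\<mu> \<in> dual_carrier (Lip0 N z) (Lip_const N) \<Longrightarrow> Lip0_functional N z \<mu>"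
  by (auto simp: Lip0_functional_def dual_carrier_def)

lemma Lip0_functional_diff:
  assumes "Lip0_functional N z \<mu>" "f \<in> Lip0 N z" "g \<in> Lip0 N z"
  shows "\<mu> (f - g) = \<mu> f - \<mu> g"
proof -
  have "f - g = f + (-1) *\<^sub>R g" by (simp add: fun_eq_iff)
  moreover have "(-1) *\<^sub>R g \<in> Lip0 N z" by (rule subspace_scale[OF subspace_Lip0 assms(3)])
  ultimately show ?thesis using assms unfolding Lip0_functional_def
    by (metis (no_types, lifting) add_uminus_conv_diff mult_minus1)
qed

text \<open>
  Boundedness of \<open>\<mu>\<close> is inherited from the combinations of evaluations that approximate it, so
  linearity and approximation decide membership in the free space. In this form membership can be
  checked for pointwise limits.
\<close>

lemma free_space_iff:
  assumes z: "z \<in> N"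
  shows "\<mu> \<in> free_space N z \<longleftrightarrow> Lip0_functional N z \<mu> \<and>
    (\<forall>e>0. \<exists>\<nu>\<in>span (delta N z ` N). \<forall>f\<in>Lip0 N z. \<bar>\<mu> f - \<nu> f\<bar> \<le> e * Lip_const N f)"
    (is "_ \<longleftrightarrow> ?R")
proof -
  interpret L: gauged_subspace "Lip0 N z" "Lip_const N" by (rule gauged_Lip0)
  show ?thesis
  proof
    assume \<mu>: "\<mu> \<in> free_space N z"
    then have \<mu>d: "\<mu> \<in> dual_carrier (Lip0 N z) (Lip_const N)" by (simp add: free_space_def)
    have "\<exists>\<nu>\<in>span (delta N z ` N). \<forall>f\<in>Lip0 N z. \<bar>\<mu> f - \<nu> f\<bar> \<le> e * Lip_const N f"
      if e: "0 < e" for e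
    proof -
      obtain \<nu> where \<nu>: "\<nu> \<in> span (delta N z ` N)" "free_norm N z (\<mu> - \<nu>) < e"
        using \<mu> e by (auto simp: free_space_def)
      have d: "\<mu> - \<nu> \<in> dual_carrier (Lip0 N z) (Lip_const N)"
        using subspace_diff[OF L.subspace_dual \<mu>d] \<nu>(1) span_delta_dual[OF z] by blast
      have "\<bar>\<mu> f - \<nu> f\<bar> \<le> e * Lip_const N f" if f: "f \<in> Lip0 N z" for f
      proof -
        have "\<bar>(\<mu> - \<nu>) f\<bar> \<le> free_norm N z (\<mu> - \<nu>) * Lip_const N f"
          unfolding free_norm_def by (rule L.dual_norm_bound[OF d f])
        also have "\<dots> \<le> e * Lip_const N f"
          using \<nu>(2) Lip_const_nonneg[OF f] by (intro mult_right_mono) auto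
        finally show ?thesis by simp
      qed
      with \<nu>(1) show ?thesis by blast
    qed
    with Lip0_functional_dual[OF \<mu>d] show ?R by blast
  next
    assume R: ?R
    have \<mu>d: "\<mu> \<in> dual_carrier (Lip0 N z) (Lip_const N)"
    proof -
      obtain \<nu> where \<nu>: "\<nu> \<in> span (delta N z ` N)"
          "\<forall>f\<in>Lip0 N z. \<bar>\<mu> f - \<nu> f\<bar> \<le> 1 * Lip_const N f"
        using R zero_less_one by blast
      obtain C where C: "\<And>f. f \<in> Lip0 N z \<Longrightarrow> \<bar>\<nu> f\<bar> \<le> C * Lip_const N f"
        using L.dual_bounded span_delta_dual[OF z] \<nu>(1) by (metis subsetD)
      show ?thesis
      proof (rule dual_carrierI[where C = "C + 1"])
        fix f assume "f \<in> Lip0 N z"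
        then show "\<bar>\<mu> f\<bar> \<le> (C + 1) * Lip_const N f"
          using C[of f] \<nu>(2) by (fastforce simp: algebra_simps)
      qed (use R in \<open>auto simp: Lip0_functional_def\<close>)
    qed
    have "\<exists>\<nu>\<in>span (delta N z ` N). free_norm N z (\<mu> - \<nu>) < e" if e: "0 < e" for e
    proof -
      obtain \<nu> where \<nu>: "\<nu> \<in> span (delta N z ` N)"
          "\<forall>f\<in>Lip0 N z. \<bar>\<mu> f - \<nu> f\<bar> \<le> e / 2 * Lip_const N f"
        using R half_gt_zero[OF e] by blast
      have "free_norm N z (\<mu> - \<nu>) \<le> e / 2"
        unfolding free_norm_def
      proof (rule L.dual_norm_le)
        fix f assume f: "f \<in> Lip0 N z" "Lip_const N f \<le> 1"
        have "\<bar>\<mu> f - \<nu> f\<bar> \<le> e / 2 * Lip_const N f" using \<nu>(2) f(1) by blast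
        also have "\<dots> \<le> e / 2 * 1" using e f(2) by (intro mult_left_mono) auto
        finally show "\<bar>(\<mu> - \<nu>) f\<bar> \<le> e / 2" by simp
      qed
      then show ?thesis using \<nu>(1) e by (intro bexI[of _ \<nu>]) auto
    qed
    with \<mu>d show "\<mu> \<in> free_space N z" by (simp add: free_space_def)
  qed
qed

lemma free_space_approx:
  assumes "z \<in> N" "\<mu> \<in> free_space N z" "0 < e"
  obtains \<nu> where "\<nu> \<in> span (delta N z ` N)"
    "\<And>f. f \<in> Lip0 N z \<Longrightarrow> \<bar>\<mu> f - \<nu> f\<bar> \<le> e * Lip_const N f"
  using assms(2,3) unfolding free_space_iff[OF assms(1)] by blast

lemma free_space_dual: "\<mu> \<in> free_space N z \<Longrightarrow> \<mu> \<in> dual_carrier (Lip0 N z) (Lip_const N)"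
  by (simp add: free_space_def)

lemma free_space_functional: "\<mu> \<in> free_space N z \<Longrightarrow> Lip0_functional N z \<mu>"
  by (intro Lip0_functional_dual free_space_dual)

lemma free_norm_bound:
  assumes "\<mu> \<in> free_space N z" "f \<in> Lip0 N z"
  shows "\<bar>\<mu> f\<bar> \<le> free_norm N z \<mu> * Lip_const N f"
  unfolding free_norm_def
  by (rule gauged_subspace.dual_norm_bound[OF gauged_Lip0 free_space_dual[OF assms(1)] assms(2)])

lemma span_delta_free_space:
  assumes "z \<in> N"
  shows "span (delta N z ` N) \<subseteq> free_space N z"
proof
  fix \<nu> assume \<nu>: "\<nu> \<in> span (delta N z ` N)"
  have "Lip0_functional N z \<nu>"
    using \<nu> span_delta_dual[OF assms] by (intro Lip0_functional_dual) auto
  with \<nu> show "\<nu> \<in> free_space N z"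
    unfolding free_space_iff[OF assms]
    by (auto intro!: bexI[of _ \<nu>] mult_nonneg_nonneg Lip_const_nonneg)
qed

lemma subspace_free_space:
  assumes z: "z \<in> N"
  shows "subspace (free_space N z)"
proof (rule subspaceI)
  show "0 \<in> free_space N z"
    using span_delta_free_space[OF z] span_zero by blast
next
  fix \<mu> \<nu> assume *: "\<mu> \<in> free_space N z" "\<nu> \<in> free_space N z"
  show "\<mu> + \<nu> \<in> free_space N z"
    unfolding free_space_iff[OF z]
  proof (intro conjI allI impI)
    show "Lip0_functional N z (\<mu> + \<nu>)"
      using *[THEN free_space_functional] by (auto simp: Lip0_functional_def algebra_simps)
    fix e :: real assume "0 < e"
    then obtain a b where ab: "a \<in> span (delta N z ` N)" "b \<in> span (delta N z ` N)"
      "\<And>f. f \<in> Lip0 N z \<Longrightarrow> \<bar>\<mu> f - a f\<bar> \<le> e/2 * Lip_const N f"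
      "\<And>f. f \<in> Lip0 N z \<Longrightarrow> \<bar>\<nu> f - b f\<bar> \<le> e/2 * Lip_const N f"
      using free_space_approx[OF z *(1), of "e/2"] free_space_approx[OF z *(2), of "e/2"]
      by (metis half_gt_zero)
    show "\<exists>\<kappa>\<in>span (delta N z ` N). \<forall>f\<in>Lip0 N z. \<bar>(\<mu> + \<nu>) f - \<kappa> f\<bar> \<le> e * Lip_const N f"
    proof (intro bexI[of _ "a + b"] ballI)
      fix f assume "f \<in> Lip0 N z"
      note ab(3,4)[OF this]
      moreover have "(\<mu> + \<nu>) f - (a + b) f = (\<mu> f - a f) + (\<nu> f - b f)" by simp
      ultimately show "\<bar>(\<mu> + \<nu>) f - (a + b) f\<bar> \<le> e * Lip_const N f"
        using abs_triangle_ineq[of "\<mu> f - a f" "\<nu> f - b f"] by (simp add: field_simps)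
    qed (rule span_add[OF ab(1,2)])
  qed
next
  fix c \<mu> assume *: "\<mu> \<in> free_space N z"
  show "c *\<^sub>R \<mu> \<in> free_space N z"
    unfolding free_space_iff[OF z]
  proof (intro conjI allI impI)
    show "Lip0_functional N z (c *\<^sub>R \<mu>)"
      using *[THEN free_space_functional] by (auto simp: Lip0_functional_def algebra_simps)
    fix e :: real assume e: "0 < e"
    obtain a where a: "a \<in> span (delta N z ` N)"
      "\<And>f. f \<in> Lip0 N z \<Longrightarrow> \<bar>\<mu> f - a f\<bar> \<le> e / (\<bar>c\<bar> + 1) * Lip_const N f"
      using free_space_approx[OF z *, of "e / (\<bar>c\<bar> + 1)"] e by auto
    show "\<exists>\<kappa>\<in>span (delta N z ` N). \<forall>f\<in>Lip0 N z. \<bar>(c *\<^sub>R \<mu>) f - \<kappa> f\<bar> \<le> e * Lip_const N f"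
    proof (intro bexI[of _ "c *\<^sub>R a"] ballI)
      fix f assume f: "f \<in> Lip0 N z"
      have "\<bar>(c *\<^sub>R \<mu>) f - (c *\<^sub>R a) f\<bar> = \<bar>c\<bar> * \<bar>\<mu> f - a f\<bar>"
        by (simp flip: right_diff_distrib abs_mult)
      also have "\<dots> \<le> \<bar>c\<bar> * (e / (\<bar>c\<bar> + 1) * Lip_const N f)"
        by (intro mult_left_mono a(2) f) simp
      also have "\<dots> = (\<bar>c\<bar> / (\<bar>c\<bar> + 1)) * (e * Lip_const N f)" by simp
      also have "\<dots> \<le> 1 * (e * Lip_const N f)"
        using e Lip_const_nonneg[OF f] by (intro mult_right_mono) auto
      finally show "\<bar>(c *\<^sub>R \<mu>) f - (c *\<^sub>R a) f\<bar> \<le> e * Lip_const N f" by simp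
    qed (rule span_scale[OF a(1)])
  qed
qed

lemma gauged_free_space:
  assumes "z \<in> N"
  shows "gauged_subspace (free_space N z) (free_norm N z)"
proof -
  interpret L: gauged_subspace "Lip0 N z" "Lip_const N" by (rule gauged_Lip0)
  show ?thesis
    by unfold_locales
      (auto simp: subspace_free_space[OF assms] free_norm_def L.dual_norm_nonneg L.dual_norm_scaleR
        free_space_dual)
qed

text \<open>
  A Lipschitz function as a functional on the free space, extended by zero as the elements of
  \<open>dual_carrier\<close> are.
\<close>

definition eval_at :: "'a::metric_space set \<Rightarrow> 'a \<Rightarrow> ('a \<Rightarrow> real) \<Rightarrow> (('a \<Rightarrow> real) \<Rightarrow> real) \<Rightarrow> real" where
  "eval_at N z f = (\<lambda>\<mu>. if \<mu> \<in> free_space N z then \<mu> f else 0)"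

lemma eval_at_dual:
  assumes z: "z \<in> N" and f: "f \<in> Lip0 N z"
  shows "eval_at N z f \<in> dual_carrier (free_space N z) (free_norm N z)"
    and "dual_norm (free_space N z) (free_norm N z) (eval_at N z f) \<le> Lip_const N f"
proof -
  interpret F: gauged_subspace "free_space N z" "free_norm N z" by (rule gauged_free_space[OF z])
  have b: "\<bar>eval_at N z f \<mu>\<bar> \<le> Lip_const N f * free_norm N z \<mu>" if "\<mu> \<in> free_space N z" for \<mu>
    using free_norm_bound[OF that f] that by (simp add: eval_at_def mult.commute)
  show "eval_at N z f \<in> dual_carrier (free_space N z) (free_norm N z)"
    by (rule dual_carrierI[where C = "Lip_const N f"])
      (auto simp: b, auto simp: eval_at_def subspace_add[OF F.subspace] subspace_scale[OF F.subspace])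
  show "dual_norm (free_space N z) (free_norm N z) (eval_at N z f) \<le> Lip_const N f"
  proof (rule F.dual_norm_le)
    fix \<mu> assume \<mu>: "\<mu> \<in> free_space N z" "free_norm N z \<mu> \<le> 1"
    have "\<bar>eval_at N z f \<mu>\<bar> \<le> Lip_const N f * free_norm N z \<mu>" by (rule b[OF \<mu>(1)])
    also have "\<dots> \<le> Lip_const N f * 1" by (rule mult_left_mono[OF \<mu>(2) Lip_const_nonneg[OF f]])
    finally show "\<bar>eval_at N z f \<mu>\<bar> \<le> Lip_const N f" by simp
  qed
qed

text \<open>
  The function that represents \<open>\<phi>\<close> is \<open>x \<mapsto> \<phi> (\<delta> x)\<close>. It is Lipschitz because \<open>\<delta> x - \<delta> y\<close> has norm
  at most \<open>dist x y\<close>, and it represents \<open>\<phi>\<close> on the span of the evaluations, hence by density on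
  the free space.
\<close>

lemma dual_free_space_represented:
  assumes z: "z \<in> N" and \<phi>: "\<phi> \<in> dual_carrier (free_space N z) (free_norm N z)"
  obtains f where "f \<in> Lip0 N z" "\<phi> = eval_at N z f"
proof -
  interpret F: gauged_subspace "free_space N z" "free_norm N z" by (rule gauged_free_space[OF z])
  interpret L: gauged_subspace "Lip0 N z" "Lip_const N" by (rule gauged_Lip0)
  have dF: "delta N z x \<in> free_space N z" if "x \<in> N" for x
    using span_delta_free_space[OF z] span_base[of "delta N z x" "delta N z ` N"] that by blast
  obtain C where C: "0 \<le> C" "\<And>\<mu>. \<mu> \<in> free_space N z \<Longrightarrow> \<bar>\<phi> \<mu>\<bar> \<le> C * free_norm N z \<mu>"
    using F.dual_bounded[OF \<phi>] by blast
  define f where "f x = (if x \<in> N then \<phi> (delta N z x) else 0)" for x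
  have f: "f \<in> Lip0 N z"
  proof (rule Lip0I[OF _ C(1)])
    have "delta N z z = 0" by (auto simp: delta_def Lip0_def fun_eq_iff)
    then show "f z = 0" by (simp add: f_def F.dual_zero[OF \<phi>])
    show "f x = 0" if "x \<notin> N" for x using that by (simp add: f_def)
    fix x y assume xy: "x \<in> N" "y \<in> N"
    have "\<bar>f x - f y\<bar> = \<bar>\<phi> (delta N z x - delta N z y)\<bar>"
      using xy F.dual_diff[OF \<phi> dF dF] by (simp add: f_def)
    also have "\<dots> \<le> C * free_norm N z (delta N z x - delta N z y)"
      using subspace_diff[OF F.subspace] dF xy by (intro C(2)) blast
    also have "\<dots> \<le> C * dist x y"
    proof (rule mult_left_mono[OF _ C(1)])
      show "free_norm N z (delta N z x - delta N z y) \<le> dist x y"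
        unfolding free_norm_def
      proof (rule L.dual_norm_le)
        fix g assume g: "g \<in> Lip0 N z" "Lip_const N g \<le> 1"
        have "\<bar>g x - g y\<bar> \<le> Lip_const N g * dist x y" by (rule Lip0_dist_le[OF g(1) xy])
        also have "\<dots> \<le> 1 * dist x y" by (rule mult_right_mono[OF g(2)]) simp
        finally show "\<bar>(delta N z x - delta N z y) g\<bar> \<le> dist x y" using g by (simp add: delta_def)
      qed
    qed
    finally show "\<bar>f x - f y\<bar> \<le> C * dist x y" .
  qed
  have eq: "\<phi> \<nu> = \<nu> f" if "\<nu> \<in> span (delta N z ` N)" for \<nu>
  proof -
    have "\<nu> \<in> {\<nu> \<in> free_space N z. \<phi> \<nu> = \<nu> f}"
    proof (rule subsetD[OF span_minimal that])
      show "delta N z ` N \<subseteq> {\<nu> \<in> free_space N z. \<phi> \<nu> = \<nu> f}"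
        using dF f by (auto simp: delta_def f_def)
      show "subspace {\<nu> \<in> free_space N z. \<phi> \<nu> = \<nu> f}"
        by (rule subspaceI) (auto simp: subspace_0[OF F.subspace] subspace_add[OF F.subspace]
            subspace_scale[OF F.subspace] F.dual_zero[OF \<phi>] dual_add[OF \<phi>] dual_scaleR[OF \<phi>])
    qed
    then show ?thesis by simp
  qed
  have "\<phi> \<mu> = \<mu> f" if \<mu>: "\<mu> \<in> free_space N z" for \<mu>
  proof -
    have "\<bar>\<phi> \<mu> - \<mu> f\<bar> \<le> 0 + e" if e: "0 < e" for e
    proof -
      define d where "d = e / (C + Lip_const N f + 1)"
      have pos: "C + Lip_const N f + 1 > 0" using C(1) Lip_const_nonneg[OF f] by simp
      then have d: "d > 0" using e by (simp add: d_def)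
      obtain \<nu> where \<nu>: "\<nu> \<in> span (delta N z ` N)"
        "\<And>g. g \<in> Lip0 N z \<Longrightarrow> \<bar>\<mu> g - \<nu> g\<bar> \<le> d * Lip_const N g"
        using free_space_approx[OF z \<mu> d] by blast
      have \<nu>F: "\<nu> \<in> free_space N z" using \<nu>(1) span_delta_free_space[OF z] by blast
      have "free_norm N z (\<mu> - \<nu>) \<le> d"
        unfolding free_norm_def
      proof (rule L.dual_norm_le)
        fix g assume g: "g \<in> Lip0 N z" "Lip_const N g \<le> 1"
        have "d * Lip_const N g \<le> d * 1" using d g(2) by (intro mult_left_mono) auto
        with \<nu>(2)[OF g(1)] show "\<bar>(\<mu> - \<nu>) g\<bar> \<le> d" by simp
      qed
      then have "\<bar>\<phi> (\<mu> - \<nu>)\<bar> \<le> C * d"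
        using C(2)[OF subspace_diff[OF F.subspace \<mu> \<nu>F]] mult_left_mono[OF _ C(1)] order_trans
        by blast
      then have "\<bar>\<phi> \<mu> - \<nu> f\<bar> \<le> C * d"
        using F.dual_diff[OF \<phi> \<mu> \<nu>F] eq[OF \<nu>(1)] by simp
      moreover have "\<bar>\<mu> f - \<nu> f\<bar> \<le> d * Lip_const N f" by (rule \<nu>(2)[OF f])
      ultimately have "\<bar>\<phi> \<mu> - \<mu> f\<bar> \<le> d * (C + Lip_const N f)" by (simp add: algebra_simps)
      also have "\<dots> \<le> d * (C + Lip_const N f + 1)" using d by (intro mult_left_mono) auto
      also have "\<dots> = e" using pos by (simp add: d_def)
      finally show ?thesis by simp
    qed
    then have "\<bar>\<phi> \<mu> - \<mu> f\<bar> \<le> 0" by (rule field_le_epsilon)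
    then show ?thesis by simp
  qed
  then have "\<phi> = eval_at N z f"
    by (auto simp: fun_eq_iff eval_at_def dual_outside[OF \<phi>])
  with f show ?thesis using that by blast
qed

text \<open>
  Elements of the free space are functions on \<open>Lip0 N z\<close>, extended by zero, and the dual acts by
  evaluation. So the weak topology is the topology of pointwise convergence, which is the topology
  of the function type.
\<close>

lemma weak_topology_free_space:
  assumes z: "z \<in> N"
  shows "weak_topology (free_space N z) (free_norm N z) = top_of_set (free_space N z)"
proof -
  interpret F: gauged_subspace "free_space N z" "free_norm N z" by (rule gauged_free_space[OF z])
  let ?V = "free_space N z" and ?W = "weak_topology (free_space N z) (free_norm N z)"
  have basic: "openin ?W {\<mu> \<in> ?V. \<phi> \<mu> \<in> S}"
    if "\<phi> \<in> dual_carrier ?V (free_norm N z)" "open S" for \<phi> S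
    unfolding weak_topology_def by (rule topology_generated_by_Basis) (use that in blast)
  have "openin ?W ?V"
    using basic[OF subspace_0[OF F.subspace_dual] open_UNIV] by simp
  have topspace: "topspace ?W = ?V"
  proof
    show "topspace ?W \<subseteq> ?V" by (auto simp: weak_topology_def)
    show "?V \<subseteq> topspace ?W" by (rule openin_subset) fact
  qed
  have "continuous_map (top_of_set ?V) ?W id"
    unfolding weak_topology_def
  proof (rule continuous_on_generated_topo)
    fix A assume "A \<in> {{x \<in> ?V. \<phi> x \<in> S} |\<phi> S. \<phi> \<in> dual_carrier ?V (free_norm N z) \<and> open S}"
    then obtain \<phi> S where A: "A = {x \<in> ?V. \<phi> x \<in> S}" "open S"
      and \<phi>: "\<phi> \<in> dual_carrier ?V (free_norm N z)" by blast
    obtain f where f: "f \<in> Lip0 N z" "\<phi> = eval_at N z f"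
      using dual_free_space_represented[OF z \<phi>] by blast
    have "open ((\<lambda>\<mu>. \<mu> f) -` S :: (('a \<Rightarrow> real) \<Rightarrow> real) set)"
      using A(2) by (intro open_vimage) auto
    moreover have "A = ?V \<inter> ((\<lambda>\<mu>. \<mu> f) -` S)" by (auto simp: A f(2) eval_at_def)
    ultimately show "openin (top_of_set ?V) (id -` A \<inter> topspace (top_of_set ?V))"
      by (auto simp: openin_open)
  next
    show "id ` topspace (top_of_set ?V) \<subseteq>
       \<Union> {{x \<in> ?V. \<phi> x \<in> S} |\<phi> S. \<phi> \<in> dual_carrier ?V (free_norm N z) \<and> open S}"
      using topspace by (simp add: weak_topology_def)
  qed
  moreover have "continuous_map ?W (top_of_set ?V) id"
    unfolding continuous_map_in_subtopology
  proof
    show "id \<in> topspace ?W \<rightarrow> ?V" by (simp add: topspace)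
    have "continuous_map ?W (product_topology (\<lambda>i. euclidean) UNIV) (\<lambda>\<mu>. id \<mu>)"
      unfolding continuous_map_componentwise_UNIV
    proof
      fix f
      show "continuous_map ?W euclideanreal (\<lambda>\<mu>. id \<mu> f)"
      proof (cases "f \<in> Lip0 N z")
        case True
        have "openin ?W {\<mu> \<in> topspace ?W. \<mu> f \<in> S}" if "open S" for S
        proof -
          have "{\<mu> \<in> topspace ?W. \<mu> f \<in> S} = {\<mu> \<in> ?V. eval_at N z f \<mu> \<in> S}"
            by (auto simp: topspace eval_at_def)
          then show ?thesis using basic[OF eval_at_dual(1)[OF z True] that] by simp
        qed
        then show ?thesis by (simp add: continuous_map_def)
      next
        case False
        have "continuous_map ?W euclideanreal (\<lambda>_. 0)" by simp
        then show ?thesis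
        proof (rule continuous_map_eq)
          fix \<mu> assume "\<mu> \<in> topspace ?W"
          then have "Lip0_functional N z \<mu>" by (simp add: topspace free_space_functional)
          then show "0 = id \<mu> f" using False by (simp add: Lip0_functional_def)
        qed
      qed
    qed
    then show "continuous_map ?W euclidean id" by (simp add: euclidean_product_topology id_def)
  qed
  ultimately have "openin (top_of_set ?V) (S \<inter> ?V)" if "openin ?W S" for S
    using that by (simp add: continuous_map_def topspace Collect_conj_eq Int_commute)
  moreover have "openin ?W (S \<inter> ?V)" if "openin (top_of_set ?V) S" for S
    using \<open>continuous_map ?W (top_of_set ?V) id\<close> that
    by (simp add: continuous_map_def topspace Collect_conj_eq Int_commute)
  ultimately have "openin ?W S \<longleftrightarrow> openin (top_of_set ?V) S" for S
    using topspace openin_subset[of ?W S] openin_subset[of "top_of_set ?V" S]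
    by (metis Int_absorb2 topspace_euclidean_subtopology)
  then show ?thesis by (simp add: topology_eq)
qed

lemma weak_compactness_free_space:
  assumes "z \<in> N" "\<Gamma> \<subseteq> free_space N z"
  shows "compactin (weak_topology (free_space N z) (free_norm N z))
       (weak_topology (free_space N z) (free_norm N z) closure_of \<Gamma>)
     \<longleftrightarrow> compact (free_space N z \<inter> closure \<Gamma>)"
  unfolding weak_topology_free_space[OF assms(1)]
  using assms(2)
  by (simp add: closure_of_subtopology compactin_subtopology Int_absorb1)

section \<open>Multiplication operators\<close>

text \<open>
  Domain and target are separate, so that the same notion covers cutting off within the whole
  space, extending by zero from \<open>N\<close> to the whole space, and restricting to \<open>N\<close>.
\<close>

definition Lip_multiplier ::
    "'a::metric_space set \<Rightarrow> 'a set \<Rightarrow> 'a \<Rightarrow> real \<Rightarrow> ('a \<Rightarrow> real) \<Rightarrow> bool" where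
  "Lip_multiplier N N' z K h \<longleftrightarrow> 0 \<le> K \<and>
     (\<forall>f\<in>Lip0 N z. h * f \<in> Lip0 N' z \<and> Lip_const N' (h * f) \<le> K * Lip_const N f)"

lemma Lip_multiplierD:
  assumes "Lip_multiplier N N' z K h"
  shows "0 \<le> K" "f \<in> Lip0 N z \<Longrightarrow> h * f \<in> Lip0 N' z"
    "f \<in> Lip0 N z \<Longrightarrow> Lip_const N' (h * f) \<le> K * Lip_const N f"
  using assms by (auto simp: Lip_multiplier_def)

lemma Lip_multiplier_one: "Lip_multiplier N N z 1 1"
  by (simp add: Lip_multiplier_def)

lemma Lip_multiplier_mult:
  assumes "Lip_multiplier N N' z K h" "Lip_multiplier N' N'' z L g"
  shows "Lip_multiplier N N'' z (L * K) (g * h)"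
  unfolding Lip_multiplier_def
proof (intro conjI ballI)
  fix f assume f: "f \<in> Lip0 N z"
  note hf = Lip_multiplierD(2,3)[OF assms(1) f]
  show "g * h * f \<in> Lip0 N'' z"
    using Lip_multiplierD(2)[OF assms(2) hf(1)] by (simp add: mult.assoc)
  have "Lip_const N'' (g * (h * f)) \<le> L * Lip_const N' (h * f)"
    by (rule Lip_multiplierD(3)[OF assms(2) hf(1)])
  also have "\<dots> \<le> L * (K * Lip_const N f)"
    by (rule mult_left_mono[OF hf(2) Lip_multiplierD(1)[OF assms(2)]])
  finally show "Lip_const N'' (g * h * f) \<le> L * K * Lip_const N f" by (simp add: mult.assoc)
qed (use assms[THEN Lip_multiplierD(1)] in simp)

lemma Lip_const_diff:
  assumes "f \<in> Lip0 N z" "g \<in> Lip0 N z"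
  shows "Lip_const N (f - g) \<le> Lip_const N f + Lip_const N g"
  unfolding fun_diff_def
  by (intro Lip_const_le lipschitz_on_diff) (use assms lipschitz_Lip_const in blast)+

lemma Lip_multiplier_diff:
  assumes "Lip_multiplier N N' z K h" "Lip_multiplier N N' z L g"
  shows "Lip_multiplier N N' z (K + L) (h - g)"
  unfolding Lip_multiplier_def
proof (intro conjI ballI)
  fix f assume f: "f \<in> Lip0 N z"
  note hf = Lip_multiplierD(2,3)[OF assms(1) f] and gf = Lip_multiplierD(2,3)[OF assms(2) f]
  have eq: "(h - g) * f = h * f - g * f" by (simp add: fun_eq_iff algebra_simps)
  show "(h - g) * f \<in> Lip0 N' z"
    unfolding eq by (rule subspace_diff[OF subspace_Lip0 hf(1) gf(1)])
  show "Lip_const N' ((h - g) * f) \<le> (K + L) * Lip_const N f"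
    unfolding eq using Lip_const_diff[OF hf(1) gf(1)] hf(2) gf(2) by (simp add: algebra_simps)
qed (use assms[THEN Lip_multiplierD(1)] in simp)

lemma Lip_multiplier_indicator:
  assumes "z \<in> N"
  shows "Lip_multiplier UNIV N z 1 (indicator N)"
  unfolding Lip_multiplier_def
proof (intro conjI ballI)
  fix f assume f: "f \<in> Lip0 UNIV z"
  have f0: "f z = 0" using f by (simp add: Lip0_def)
  have "\<bar>(indicator N * f) x - (indicator N * f) y\<bar> \<le> Lip_const UNIV f * dist x y"
    if "x \<in> N" "y \<in> N" for x y
    using Lip0_dist_le[OF f, of x y] that by simp
  then show "indicator N * f \<in> Lip0 N z" "Lip_const N (indicator N * f) \<le> 1 * Lip_const UNIV f"
    using Lip0I[of "indicator N * f" z "Lip_const UNIV f" N] Lip_const_nonneg[OF f] f0 by simp_all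
qed simp

text \<open>McShane's extension: the largest extension with the same Lipschitz constant.\<close>

lemma Lip0_extension:
  assumes z: "z \<in> N" and f: "f \<in> Lip0 N z"
  obtains g where "g \<in> Lip0 UNIV z" "Lip_const UNIV g \<le> Lip_const N f" "\<And>x. x \<in> N \<Longrightarrow> g x = f x"
proof -
  define L where "L = Lip_const N f"
  have L: "0 \<le> L" unfolding L_def by (rule Lip_const_nonneg[OF f])
  have fL: "f u \<le> f v + L * dist u v" if "u \<in> N" "v \<in> N" for u v
    using Lip0_dist_le[OF f that] by (simp add: L_def)
  define g where "g x = (INF u\<in>N. f u + L * dist x u)" for x
  have bdd: "bdd_below ((\<lambda>u. f u + L * dist x u) ` N)" for x
  proof (rule bdd_belowI2)
    fix u assume u: "u \<in> N"
    have "L * dist z u \<le> L * (dist x z + dist x u)"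
      by (rule mult_left_mono[OF _ L]) (metis dist_commute dist_triangle)
    with fL[OF z u] show "f z - L * dist x z \<le> f u + L * dist x u" by (simp add: distrib_left)
  qed
  have le: "g x \<le> g y + L * dist x y" for x y
  proof -
    have "g x - L * dist x y \<le> g y"
      unfolding g_def[of y]
    proof (rule cINF_greatest)
      fix u assume u: "u \<in> N"
      have "g x \<le> f u + L * dist x u" unfolding g_def by (rule cINF_lower[OF bdd u])
      moreover have "L * dist x u \<le> L * (dist x y + dist y u)"
        by (rule mult_left_mono[OF dist_triangle L])
      ultimately show "g x - L * dist x y \<le> f u + L * dist y u" by (simp add: distrib_left)
    qed (use z in blast)
    then show ?thesis by simp
  qed
  have eq: "g x = f x" if x: "x \<in> N" for x
  proof (rule antisym)
    show "g x \<le> f x" unfolding g_def using cINF_lower[OF bdd x, of x] by simp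
    show "f x \<le> g x" unfolding g_def using x by (intro cINF_greatest) (auto intro: fL)
  qed
  have "\<bar>g x - g y\<bar> \<le> L * dist x y" for x y
    using le[of x y] le[of y x] by (simp add: dist_commute abs_le_iff)
  moreover have "g z = 0" using eq[OF z] f by (simp add: Lip0_def)
  ultimately show ?thesis
    using Lip0I[of g z L UNIV] L eq that unfolding L_def by auto
qed

text \<open>
  A function supported in \<open>N\<close> only sees the values on \<open>N\<close>, which a McShane extension does not
  change.
\<close>

lemma Lip_multiplier_extend:
  assumes z: "z \<in> N" and h: "Lip_multiplier UNIV UNIV z K h" and off: "\<And>x. x \<notin> N \<Longrightarrow> h x = 0"
  shows "Lip_multiplier N UNIV z K h"
  unfolding Lip_multiplier_def
proof (intro conjI ballI)
  fix f assume f: "f \<in> Lip0 N z"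
  obtain g where g: "g \<in> Lip0 UNIV z" "Lip_const UNIV g \<le> Lip_const N f" "\<And>x. x \<in> N \<Longrightarrow> g x = f x"
    using Lip0_extension[OF z f] by blast
  have eq: "h * f = h * g" using g(3) off by (fastforce simp: fun_eq_iff)
  show "h * f \<in> Lip0 UNIV z" unfolding eq by (rule Lip_multiplierD(2)[OF h g(1)])
  have "Lip_const UNIV (h * g) \<le> K * Lip_const UNIV g" by (rule Lip_multiplierD(3)[OF h g(1)])
  also have "\<dots> \<le> K * Lip_const N f" by (rule mult_left_mono[OF g(2) Lip_multiplierD(1)[OF h]])
  finally show "Lip_const UNIV (h * f) \<le> K * Lip_const N f" unfolding eq .
qed (rule Lip_multiplierD(1)[OF h])

text \<open>
  The preadjoint of \<open>f \<mapsto> h * f\<close>. If \<open>h\<close> multiplies \<open>Lip0 N z\<close> to \<open>Lip0 N' z\<close>, it leads from functionals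
  on \<open>Lip0 N' z\<close> to functionals on \<open>Lip0 N z\<close>, and it maps the free space over \<open>N'\<close> to the free space
  over \<open>N\<close>, because the evaluation at \<open>x\<close> goes to \<open>h x\<close> times the evaluation at \<open>x\<close>.
\<close>

definition mulop ::
    "'a::metric_space set \<Rightarrow> 'a \<Rightarrow> ('a \<Rightarrow> real) \<Rightarrow> (('a \<Rightarrow> real) \<Rightarrow> real) \<Rightarrow> ('a \<Rightarrow> real) \<Rightarrow> real" where
  "mulop N z h \<mu> = (\<lambda>f. if f \<in> Lip0 N z then \<mu> (h * f) else 0)"

lemma mulop_add: "mulop N z h (\<mu> + \<nu>) = mulop N z h \<mu> + mulop N z h \<nu>"
  by (auto simp: mulop_def fun_eq_iff)

lemma mulop_scaleR: "mulop N z h (c *\<^sub>R \<mu>) = c *\<^sub>R mulop N z h \<mu>"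
  by (auto simp: mulop_def fun_eq_iff)

lemma mulop_mulop:
  assumes "Lip_multiplier N N' z K h"
  shows "mulop N z h (mulop N' z g \<mu>) = mulop N z (g * h) \<mu>"
  using Lip_multiplierD(2)[OF assms] by (auto simp: mulop_def fun_eq_iff mult.assoc)

lemma mulop_one: "Lip0_functional N z \<mu> \<Longrightarrow> mulop N z 1 \<mu> = \<mu>"
  by (auto simp: mulop_def fun_eq_iff Lip0_functional_def)

lemma mulop_functional:
  assumes h: "Lip_multiplier N N' z K h" and \<mu>: "Lip0_functional N' z \<mu>"
  shows "Lip0_functional N z (mulop N z h \<mu>)"
proof -
  have "h * (f + g) = h * f + h * g" "h * (c *\<^sub>R f) = c *\<^sub>R (h * f)" for f g c
    by (auto simp: fun_eq_iff algebra_simps)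
  then show ?thesis
    using \<mu> Lip_multiplierD(2)[OF h] unfolding Lip0_functional_def mulop_def
    by (simp add: subspace_add[OF subspace_Lip0] subspace_scale[OF subspace_Lip0])
qed

lemma mulop_diff:
  assumes "Lip_multiplier N N' z K h" "Lip_multiplier N N' z L g" "Lip0_functional N' z \<mu>"
  shows "mulop N z (h - g) \<mu> = mulop N z h \<mu> - mulop N z g \<mu>"
proof -
  have "(h - g) * f = h * f - g * f" for f by (simp add: fun_eq_iff algebra_simps)
  then show ?thesis
    using Lip0_functional_diff[OF assms(3)] assms(1,2)[THEN Lip_multiplierD(2)]
    by (intro ext) (simp add: mulop_def)
qed

lemma mulop_span_delta:
  assumes h: "Lip_multiplier N N' z K h" and \<nu>: "\<nu> \<in> span (delta N' z ` N')"
  shows "mulop N z h \<nu> \<in> span (delta N z ` N)"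
proof -
  have "\<nu> \<in> {\<nu>. mulop N z h \<nu> \<in> span (delta N z ` N)}"
  proof (rule subsetD[OF span_minimal \<nu>])
    show "delta N' z ` N' \<subseteq> {\<nu>. mulop N z h \<nu> \<in> span (delta N z ` N)}"
    proof safe
      fix x assume "x \<in> N'"
      show "mulop N z h (delta N' z x) \<in> span (delta N z ` N)"
      proof (cases "x \<in> N")
        case True
        have "mulop N z h (delta N' z x) = h x *\<^sub>R delta N z x"
          using Lip_multiplierD(2)[OF h] by (auto simp: mulop_def delta_def fun_eq_iff)
        then show ?thesis using True by (simp add: span_base span_scale)
      next
        case False
        have "mulop N z h (delta N' z x) = 0"
          using False by (auto simp: mulop_def delta_def fun_eq_iff Lip0_def)
        then show ?thesis by (simp add: span_zero)
      qed
    qed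
    show "subspace {\<nu>. mulop N z h \<nu> \<in> span (delta N z ` N)}"
    proof (rule subspaceI)
      have "mulop N z h 0 = 0" by (auto simp: mulop_def fun_eq_iff)
      then show "0 \<in> {\<nu>. mulop N z h \<nu> \<in> span (delta N z ` N)}" by (simp add: span_zero)
    qed (auto simp: mulop_add mulop_scaleR span_add span_scale)
  qed
  then show ?thesis by simp
qed

lemma mulop_free_space:
  assumes "z \<in> N" "z \<in> N'" and h: "Lip_multiplier N N' z K h" and \<mu>: "\<mu> \<in> free_space N' z"
  shows "mulop N z h \<mu> \<in> free_space N z"
  unfolding free_space_iff[OF assms(1)]
proof (intro conjI allI impI)
  show "Lip0_functional N z (mulop N z h \<mu>)"
    by (rule mulop_functional[OF h free_space_functional[OF \<mu>]])
next
  fix e :: real assume e: "0 < e"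
  have K: "0 \<le> K" by (rule Lip_multiplierD(1)[OF h])
  obtain \<nu> where \<nu>: "\<nu> \<in> span (delta N' z ` N')"
    "\<And>f. f \<in> Lip0 N' z \<Longrightarrow> \<bar>\<mu> f - \<nu> f\<bar> \<le> e / (K + 1) * Lip_const N' f"
    using free_space_approx[OF assms(2) \<mu>, of "e / (K + 1)"] e K by auto
  have "\<bar>mulop N z h \<mu> f - mulop N z h \<nu> f\<bar> \<le> e * Lip_const N f" if f: "f \<in> Lip0 N z" for f
  proof -
    have "\<bar>mulop N z h \<mu> f - mulop N z h \<nu> f\<bar> \<le> e / (K + 1) * Lip_const N' (h * f)"
      using \<nu>(2)[OF Lip_multiplierD(2)[OF h f]] f by (simp add: mulop_def)
    also have "\<dots> \<le> e / (K + 1) * (K * Lip_const N f)"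
      using e K by (intro mult_left_mono Lip_multiplierD(3)[OF h f]) simp
    also have "\<dots> = (K / (K + 1)) * (e * Lip_const N f)" by simp
    also have "\<dots> \<le> 1 * (e * Lip_const N f)"
      using e K Lip_const_nonneg[OF f] by (intro mult_right_mono) auto
    finally show ?thesis by simp
  qed
  then show "\<exists>\<nu>\<in>span (delta N z ` N). \<forall>f\<in>Lip0 N z. \<bar>mulop N z h \<mu> f - \<nu> f\<bar> \<le> e * Lip_const N f"
    using mulop_span_delta[OF h \<nu>(1)] by blast
qed

lemma mulop_Vstar_set:
  assumes "z \<in> N" "z \<in> N'" and h: "Lip_multiplier N N' z K h"
    and \<Gamma>: "Vstar_set (free_space N' z) (free_norm N' z) \<Gamma>"
  shows "Vstar_set (free_space N z) (free_norm N z) (mulop N z h ` \<Gamma>)"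
proof (rule Vstar_set_image[OF gauged_free_space gauged_free_space _ mulop_add mulop_scaleR _ \<Gamma>])
  show "mulop N z h ` free_space N' z \<subseteq> free_space N z"
    using mulop_free_space[OF assms(1-3)] by blast
  show "free_norm N z (mulop N z h \<mu>) \<le> K * free_norm N' z \<mu>" if \<mu>: "\<mu> \<in> free_space N' z" for \<mu>
    unfolding free_norm_def[of N]
  proof (rule gauged_subspace.dual_norm_le[OF gauged_Lip0])
    fix f assume f: "f \<in> Lip0 N z" "Lip_const N f \<le> 1"
    have n0: "0 \<le> free_norm N' z \<mu>"
      by (rule gauged_subspace.gauge_nonneg[OF gauged_free_space[OF assms(2)] \<mu>])
    have "\<bar>mulop N z h \<mu> f\<bar> \<le> free_norm N' z \<mu> * Lip_const N' (h * f)"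
      using free_norm_bound[OF \<mu> Lip_multiplierD(2)[OF h f(1)]] f(1) by (simp add: mulop_def)
    also have "\<dots> \<le> free_norm N' z \<mu> * (K * 1)"
      using Lip_multiplierD(3)[OF h f(1)] mult_left_mono[OF f(2) Lip_multiplierD(1)[OF h]] n0
      by (intro mult_left_mono) auto
    finally show "\<bar>mulop N z h \<mu> f\<bar> \<le> K * free_norm N' z \<mu>" by (simp add: mult.commute)
  qed
qed (use assms in auto)

text \<open>
  A bounded function \<open>h\<close> multiplies Lipschitz functions vanishing at \<open>z\<close> to Lipschitz functions as
  soon as its slope near \<open>y\<close> is at most of order \<open>1 / dist y z\<close>, because \<open>\<bar>f y\<bar> \<le> L * dist y z\<close>.
\<close>

lemma Lip_multiplier_if_slope:
  assumes K: "0 \<le> K" and h1: "\<And>x. \<bar>h x\<bar> \<le> 1"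
    and slope: "\<And>x y. \<bar>h x - h y\<bar> * dist y z \<le> K * dist x y"
  shows "Lip_multiplier UNIV UNIV z (1 + K) h"
  unfolding Lip_multiplier_def
proof (intro conjI ballI)
  fix f assume f: "f \<in> Lip0 UNIV z"
  define L where "L = Lip_const UNIV f"
  have L: "0 \<le> L" unfolding L_def by (rule Lip_const_nonneg[OF f])
  have "\<bar>(h * f) x - (h * f) y\<bar> \<le> ((1 + K) * L) * dist x y" for x y
  proof -
    have "(h * f) x - (h * f) y = h x * (f x - f y) + (h x - h y) * f y"
      by (simp add: algebra_simps)
    also have "\<bar>\<dots>\<bar> \<le> \<bar>h x\<bar> * \<bar>f x - f y\<bar> + \<bar>h x - h y\<bar> * \<bar>f y\<bar>"
      by (metis abs_mult abs_triangle_ineq)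
    also have "\<bar>h x\<bar> * \<bar>f x - f y\<bar> \<le> 1 * (L * dist x y)"
      using Lip0_dist_le[OF f, of x y] h1 by (intro mult_mono) (auto simp: L_def)
    also have "\<bar>h x - h y\<bar> * \<bar>f y\<bar> \<le> \<bar>h x - h y\<bar> * (L * dist y z)"
      using Lip0_abs_le[OF f, of y] by (intro mult_left_mono) (auto simp: L_def)
    also have "\<dots> = L * (\<bar>h x - h y\<bar> * dist y z)" by simp
    also have "\<dots> \<le> L * (K * dist x y)" by (rule mult_left_mono[OF slope L])
    finally show ?thesis by (simp add: algebra_simps)
  qed
  moreover have "(h * f) z = 0" using f by (simp add: Lip0_def)
  ultimately show "h * f \<in> Lip0 UNIV z" "Lip_const UNIV (h * f) \<le> (1 + K) * Lip_const UNIV f"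
    using Lip0I[of "h * f" z "(1 + K) * L" UNIV] K L unfolding L_def by auto
qed (use K in simp)

text \<open>
  The width of the transition zone of \<open>u\<close> is proportional to \<open>1 + dist x z\<close>: a fixed width would
  give slopes that are too large far from \<open>z\<close>, where Lipschitz functions are large.
\<close>

definition cutoff :: "'a::metric_space \<Rightarrow> real \<Rightarrow> real \<Rightarrow> ('a \<Rightarrow> real) \<Rightarrow> 'a \<Rightarrow> real" where
  "cutoff z d s u x = max 0 (min 1 (s - u x / (d * (1 + dist x z))))"

lemma scale_pos: "0 < d \<Longrightarrow> 0 < d * (1 + dist x z)"
  by (intro mult_pos_pos) (auto intro: add_pos_nonneg)

lemma cutoff_eq_0_iff:
  assumes "0 < d"
  shows "cutoff z d s u x = 0 \<longleftrightarrow> s * (d * (1 + dist x z)) \<le> u x"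
proof -
  have "cutoff z d s u x = 0 \<longleftrightarrow> s \<le> u x / (d * (1 + dist x z))"
    unfolding cutoff_def by linarith
  then show ?thesis by (simp only: pos_le_divide_eq[OF scale_pos[OF assms]])
qed

lemma cutoff_eq_1_iff:
  assumes "0 < d"
  shows "cutoff z d s u x = 1 \<longleftrightarrow> u x \<le> (s - 1) * (d * (1 + dist x z))"
proof -
  have "cutoff z d s u x = 1 \<longleftrightarrow> u x / (d * (1 + dist x z)) \<le> s - 1"
    unfolding cutoff_def by linarith
  then show ?thesis by (simp only: pos_divide_le_eq[OF scale_pos[OF assms]])
qed

lemma Lip_multiplier_cutoff:
  assumes d: "0 < d" and A: "0 \<le> A"
    and u: "\<And>x. 0 \<le> u x" "\<And>x. u x \<le> A * (1 + dist x z)" "\<And>x y. \<bar>u x - u y\<bar> \<le> dist x y"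
  shows "Lip_multiplier UNIV UNIV z (1 + (1 + A) / d) (cutoff z d s u)"
proof (rule Lip_multiplier_if_slope)
  show "\<bar>cutoff z d s u x\<bar> \<le> 1" for x by (auto simp: cutoff_def)
  show "\<bar>cutoff z d s u x - cutoff z d s u y\<bar> * dist y z \<le> (1 + A) / d * dist x y" for x y
  proof -
    define r where "r x = 1 + dist x z" for x
    have r: "0 < r x" for x by (simp add: r_def add_pos_nonneg)
    have "\<bar>cutoff z d s u x - cutoff z d s u y\<bar> \<le> \<bar>u x / (d * r x) - u y / (d * r y)\<bar>"
      unfolding cutoff_def r_def by linarith
    then have "\<bar>cutoff z d s u x - cutoff z d s u y\<bar> * dist y z
        \<le> \<bar>u x / (d * r x) - u y / (d * r y)\<bar> * r y"
      by (intro mult_mono) (auto simp: r_def)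
    also have "\<dots> = \<bar>(u x / (d * r x) - u y / (d * r y)) * r y\<bar>"
      using r[of y] by (simp add: abs_mult)
    also have "(u x / (d * r x) - u y / (d * r y)) * r y
        = ((u x - u y) + u x / r x * (r y - r x)) / d"
      using d r[of x] r[of y] by (simp add: field_simps)
    also have "\<bar>\<dots>\<bar> = \<bar>(u x - u y) + u x / r x * (r y - r x)\<bar> / d"
      using d by simp
    also have "\<dots> \<le> (dist x y + A * dist x y) / d"
    proof (rule divide_right_mono)
      have "\<bar>u x / r x * (r y - r x)\<bar> = u x / r x * \<bar>r y - r x\<bar>"
        using u(1)[of x] r[of x] by (simp add: abs_mult)
      also have "\<dots> \<le> A * dist x y"
      proof (rule mult_mono)
        show "u x / r x \<le> A" using u(2)[of x] r[of x] by (simp add: pos_divide_le_eq r_def)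
        show "\<bar>r y - r x\<bar> \<le> dist x y"
          using dist_triangle[of x z y] dist_triangle[of y z x]
          by (simp add: r_def dist_commute abs_le_iff)
      qed (use A in auto)
      finally show "\<bar>(u x - u y) + u x / r x * (r y - r x)\<bar> \<le> dist x y + A * dist x y"
        using u(3)[of x y] by linarith
    qed (use d in simp)
    finally show ?thesis by (simp add: algebra_simps add_divide_distrib)
  qed
qed (use d A in simp)

lemma Lip_multiplier_cutoff_infdist:
  assumes "0 < d" "z \<in> E"
  shows "Lip_multiplier UNIV UNIV z (1 + 2 / d) (cutoff z d s (\<lambda>x. infdist x E))"
proof -
  have "infdist x E \<le> 1 * (1 + dist x z)" for x
    using infdist_le[OF assms(2), of x] by simp
  from Lip_multiplier_cutoff[OF assms(1) _ infdist_nonneg this infdist_triangle_abs, of s]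
  show ?thesis by simp
qed

lemma Lip_multiplier_cutoff_dist:
  assumes "0 < d"
  shows "Lip_multiplier UNIV UNIV z (1 + (2 + dist z p) / d) (cutoff z d s (\<lambda>x. dist x p))"
proof -
  have "dist x p \<le> (1 + dist z p) * (1 + dist x z)" for x
  proof -
    have "dist x p \<le> dist x z + dist z p" by (rule dist_triangle)
    also have "\<dots> \<le> (1 + dist z p) * (1 + dist x z)" by (simp add: algebra_simps)
    finally show ?thesis .
  qed
  moreover have "\<bar>dist x p - dist y p\<bar> \<le> dist x y" for x y
    using dist_triangle[of x p y] dist_triangle[of y p x] by (simp add: dist_commute abs_le_iff)
  ultimately show ?thesis
    using Lip_multiplier_cutoff[OF assms, of "1 + dist z p" "\<lambda>x. dist x p" z s]
    by (simp add: add.assoc)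
qed

section \<open>The gliding hump\<close>

text \<open>
  The signed sums of the \<open>F k\<close> bound those of the evaluations at \<open>F k\<close> in the dual of the free space,
  so these evaluations form a WUC series, on which a (V*)-set is uniformly small.
\<close>

lemma Vstar_set_small_if_bounded_sums:
  fixes F :: "nat \<Rightarrow> 'a::metric_space \<Rightarrow> real"
  assumes z: "z \<in> N" and \<Gamma>: "Vstar_set (free_space N z) (free_norm N z) \<Gamma>"
    and F: "\<And>k. F k \<in> Lip0 N z"
    and bound: "\<And>m s. (\<And>k. \<bar>s k\<bar> \<le> 1) \<Longrightarrow> Lip_const N (\<Sum>k<m. s k *\<^sub>R F k) \<le> C"
    and e: "0 < e"
  obtains k where "\<And>\<mu>. \<mu> \<in> \<Gamma> \<Longrightarrow> \<bar>\<mu> (F k)\<bar> \<le> e"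
proof -
  let ?V = "free_space N z" and ?n = "free_norm N z"
  interpret F: gauged_subspace ?V ?n by (rule gauged_free_space[OF z])
  interpret L: gauged_subspace "Lip0 N z" "Lip_const N" by (rule gauged_Lip0)
  have "WUC (dual_carrier ?V ?n) (dual_norm ?V ?n) (\<lambda>k. eval_at N z (F k))"
  proof (rule gauged_subspace.WUC_if_bounded_signed_sums[OF F.gauged_dual])
    show "range (\<lambda>k. eval_at N z (F k)) \<subseteq> dual_carrier ?V ?n"
      using eval_at_dual(1)[OF z F] by blast
  next
    fix m and s :: "nat \<Rightarrow> real"
    assume s: "\<And>k. \<bar>s k\<bar> \<le> 1"
    have sum_apply: "(\<Sum>k\<in>A. s k *\<^sub>R eval_at N z (F k)) \<mu> = (\<Sum>k\<in>A. s k * eval_at N z (F k) \<mu>)"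
      if "finite A" for A \<mu>
      using that by (induction A rule: finite_induct) auto
    have eq: "(\<Sum>k<m. s k *\<^sub>R eval_at N z (F k)) = eval_at N z (\<Sum>k<m. s k *\<^sub>R F k)"
    proof
      fix \<mu>
      show "(\<Sum>k<m. s k *\<^sub>R eval_at N z (F k)) \<mu> = eval_at N z (\<Sum>k<m. s k *\<^sub>R F k) \<mu>"
        unfolding sum_apply[OF finite_lessThan]
        using L.dual_sum[OF free_space_dual finite_lessThan, of \<mu> m F s] F
        by (simp add: eval_at_def)
    qed
    have "(\<Sum>k<m. s k *\<^sub>R F k) \<in> Lip0 N z"
      by (intro subspace_sum[OF subspace_Lip0] subspace_scale[OF subspace_Lip0] F)
    from order_trans[OF eval_at_dual(2)[OF z this] bound[OF s]]
    show "dual_norm ?V ?n (\<Sum>k<m. s k *\<^sub>R eval_at N z (F k)) \<le> C"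
      unfolding eq .
  qed
  from Vstar_set_small[OF \<Gamma> this e] obtain k
    where k: "\<And>\<mu>. \<mu> \<in> \<Gamma> \<Longrightarrow> \<bar>eval_at N z (F k) \<mu>\<bar> \<le> e" by blast
  show ?thesis
  proof (rule that[of k])
    fix \<mu> assume \<mu>: "\<mu> \<in> \<Gamma>"
    then have "\<mu> \<in> ?V" using \<Gamma> by (auto simp: Vstar_set_def)
    then show "\<bar>\<mu> (F k)\<bar> \<le> e" using k[OF \<mu>] by (simp add: eval_at_def)
  qed
qed

text \<open>
  The series with terms \<open>f / 2 ^ k\<close> is WUC, and a (V*)-set is bounded on some term of it.
\<close>

lemma Vstar_set_pointwise_bounded:
  assumes z: "z \<in> N" and \<Gamma>: "Vstar_set (free_space N z) (free_norm N z) \<Gamma>"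
    and f: "f \<in> Lip0 N z"
  obtains B where "\<And>\<mu>. \<mu> \<in> \<Gamma> \<Longrightarrow> \<bar>\<mu> f\<bar> \<le> B"
proof -
  let ?F = "\<lambda>k::nat. (1 / 2) ^ k *\<^sub>R f"
  have "Lip_const N (\<Sum>k<m. s k *\<^sub>R ?F k) \<le> 2 * Lip_const N f"
    if s: "\<And>k. \<bar>s k\<bar> \<le> 1" for m and s :: "nat \<Rightarrow> real"
  proof -
    have "(\<Sum>k<m. s k *\<^sub>R ?F k) = (\<Sum>k<m. s k * (1 / 2) ^ k) *\<^sub>R f"
      by (simp add: scaleR_sum_left)
    then have "Lip_const N (\<Sum>k<m. s k *\<^sub>R ?F k) = \<bar>\<Sum>k<m. s k * (1 / 2) ^ k\<bar> * Lip_const N f"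
      by (simp add: gauged_subspace.gauge_scaleR[OF gauged_Lip0 f])
    also have "\<bar>\<Sum>k<m. s k * (1 / 2) ^ k\<bar> \<le> (\<Sum>k<m. (1 / 2) ^ k)"
    proof (rule order_trans[OF sum_abs sum_mono])
      show "\<bar>s k * (1 / 2) ^ k\<bar> \<le> (1 / 2) ^ k" for k
        using mult_right_mono[OF s, of "(1 / 2) ^ k" k] by (simp add: abs_mult)
    qed
    also have "(\<Sum>k<m. (1 / 2 :: real) ^ k) \<le> 2"
      by (simp add: sum_gp_strict)
    finally show ?thesis using Lip_const_nonneg[OF f] by (simp add: mult_right_mono)
  qed
  from Vstar_set_small_if_bounded_sums[OF z \<Gamma> subspace_scale[OF subspace_Lip0 f] this zero_less_one]
  obtain k where k: "\<And>\<mu>. \<mu> \<in> \<Gamma> \<Longrightarrow> \<bar>\<mu> (?F k)\<bar> \<le> 1" by blast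
  show ?thesis
  proof (rule that[of "2 ^ k"])
    fix \<mu> assume \<mu>: "\<mu> \<in> \<Gamma>"
    then have "\<mu> \<in> free_space N z" using \<Gamma> by (auto simp: Vstar_set_def)
    then have eq: "\<mu> (?F k) = (1 / 2) ^ k * \<mu> f"
      using f free_space_functional[of \<mu> N z] by (simp add: Lip0_functional_def)
    have "\<bar>(1 / 2) ^ k * \<mu> f\<bar> \<le> 1" using k[OF \<mu>] unfolding eq .
    then show "\<bar>\<mu> f\<bar> \<le> 2 ^ k" by (simp add: abs_mult power_one_over field_simps)
  qed
qed

text \<open>
  At two points \<open>x\<close> and \<open>y\<close> at most two of the \<open>F k\<close> are nonzero, and each contributes at most
  \<open>L * dist x y\<close> to the difference of the values. Uniformly Lipschitz functions with disjoint supports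
  therefore form a WUC series.
\<close>

lemma Lip_const_disjoint_sum:
  fixes F :: "nat \<Rightarrow> 'a::metric_space \<Rightarrow> real"
  assumes F: "\<And>k. F k \<in> Lip0 N z" "\<And>k. Lip_const N (F k) \<le> L"
    and disjoint: "\<And>j k x. j \<noteq> k \<Longrightarrow> F j x = 0 \<or> F k x = 0"
    and s: "\<And>k. \<bar>s k\<bar> \<le> 1"
  shows "Lip_const N (\<Sum>k<m. s k *\<^sub>R F k) \<le> 2 * L"
proof -
  have L: "0 \<le> L" using Lip_const_nonneg[OF F(1)] F(2) order_trans by blast
  have sum_apply: "(\<Sum>k\<in>A. s k *\<^sub>R F k) x = (\<Sum>k\<in>A. s k * F k x)" if "finite A" for A x
    using that by (induction A rule: finite_induct) auto
  show ?thesis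
  proof (rule Lip0I(2)[of _ z])
    fix x y assume xy: "x \<in> N" "y \<in> N"
    define A where "A u = {k. k < m \<and> F k u \<noteq> 0}" for u
    have card1: "card (A u) \<le> 1" for u
      using disjoint by (auto simp: card_le_Suc0_iff_eq A_def)
    have "\<bar>(\<Sum>k<m. s k *\<^sub>R F k) x - (\<Sum>k<m. s k *\<^sub>R F k) y\<bar> = \<bar>\<Sum>k<m. s k * (F k x - F k y)\<bar>"
      by (simp add: sum_apply sum_subtractf right_diff_distrib)
    also have "(\<Sum>k<m. s k * (F k x - F k y)) = (\<Sum>k\<in>A x \<union> A y. s k * (F k x - F k y))"
      by (rule sum.mono_neutral_right) (auto simp: A_def)
    also have "\<bar>\<dots>\<bar> \<le> (\<Sum>k\<in>A x \<union> A y. L * dist x y)"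
    proof (rule order_trans[OF sum_abs sum_mono])
      fix k
      have "\<bar>s k * (F k x - F k y)\<bar> \<le> 1 * \<bar>F k x - F k y\<bar>"
        unfolding abs_mult by (rule mult_right_mono[OF s]) simp
      also have "\<dots> \<le> Lip_const N (F k) * dist x y" using Lip0_dist_le[OF F(1) xy] by simp
      also have "\<dots> \<le> L * dist x y" by (rule mult_right_mono[OF F(2)]) simp
      finally show "\<bar>s k * (F k x - F k y)\<bar> \<le> L * dist x y" .
    qed
    also have "\<dots> = real (card (A x \<union> A y)) * (L * dist x y)" by simp
    also have "\<dots> \<le> 2 * (L * dist x y)"
    proof (rule mult_right_mono)
      have "card (A x \<union> A y) \<le> card (A x) + card (A y)" by (rule card_Un_le)
      then show "real (card (A x \<union> A y)) \<le> 2" using card1[of x] card1[of y] by linarith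
    qed (simp add: L)
    finally show "\<bar>(\<Sum>k<m. s k *\<^sub>R F k) x - (\<Sum>k<m. s k *\<^sub>R F k) y\<bar> \<le> 2 * L * dist x y"
      by (simp only: mult.assoc)
  qed (use F(1) L in \<open>auto simp: sum_apply Lip0_def\<close>)
qed

lemma span_delta_finite_support:
  fixes \<nu> :: "('a::metric_space \<Rightarrow> real) \<Rightarrow> real"
  assumes "\<nu> \<in> span (delta N z ` N)"
  obtains E where "finite E" "E \<subseteq> N"
    "\<forall>f\<in>Lip0 N z. \<forall>g\<in>Lip0 N z. (\<forall>x\<in>E. f x = g x) \<longrightarrow> \<nu> f = \<nu> g"
proof -
  let ?P = "\<lambda>E (\<nu> :: ('a \<Rightarrow> real) \<Rightarrow> real). finite E \<and> E \<subseteq> N \<and>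
     (\<forall>f\<in>Lip0 N z. \<forall>g\<in>Lip0 N z. (\<forall>x\<in>E. f x = g x) \<longrightarrow> \<nu> f = \<nu> g)"
  have "\<nu> \<in> {\<nu>. \<exists>E. ?P E \<nu>}"
  proof (rule subsetD[OF span_minimal assms])
    show "delta N z ` N \<subseteq> {\<nu>. \<exists>E. ?P E \<nu>}"
    proof safe
      fix x assume "x \<in> N"
      then have "?P {x} (delta N z x)" by (auto simp: delta_def)
      then show "\<exists>E. ?P E (delta N z x)" ..
    qed
    show "subspace {\<nu>. \<exists>E. ?P E \<nu>}"
    proof (rule subspaceI)
      have "?P {} 0" by simp
      then show "0 \<in> {\<nu>. \<exists>E. ?P E \<nu>}" unfolding mem_Collect_eq by (rule exI)
    next
      fix \<mu> \<nu> assume "\<mu> \<in> {\<nu>. \<exists>E. ?P E \<nu>}" "\<nu> \<in> {\<nu>. \<exists>E. ?P E \<nu>}"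
      then obtain D E where DE: "?P D \<mu>" "?P E \<nu>" by blast
      have "?P (D \<union> E) (\<mu> + \<nu>)"
      proof (intro conjI ballI impI)
        fix f g assume fg: "f \<in> Lip0 N z" "g \<in> Lip0 N z" and eq: "\<forall>x\<in>D \<union> E. f x = g x"
        from eq have "\<forall>x\<in>D. f x = g x" "\<forall>x\<in>E. f x = g x" by blast+
        with DE fg have "\<mu> f = \<mu> g" "\<nu> f = \<nu> g" by blast+
        then show "(\<mu> + \<nu>) f = (\<mu> + \<nu>) g" by simp
      qed (use DE in blast)+
      then show "\<mu> + \<nu> \<in> {\<nu>. \<exists>E. ?P E \<nu>}" unfolding mem_Collect_eq by (rule exI)
    next
      fix c \<mu> assume "\<mu> \<in> {\<nu>. \<exists>E. ?P E \<nu>}"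
      then obtain D where D: "?P D \<mu>" by blast
      have "?P D (c *\<^sub>R \<mu>)"
      proof (intro conjI ballI impI)
        fix f g assume "f \<in> Lip0 N z" "g \<in> Lip0 N z" "\<forall>x\<in>D. f x = g x"
        with D have "\<mu> f = \<mu> g" by blast
        then show "(c *\<^sub>R \<mu>) f = (c *\<^sub>R \<mu>) g" by simp
      qed (use D in blast)+
      then show "c *\<^sub>R \<mu> \<in> {\<nu>. \<exists>E. ?P E \<nu>}" unfolding mem_Collect_eq by (rule exI)
    qed
  qed
  then obtain E where "?P E \<nu>" by blast
  then show ?thesis by (intro that[of E]) blast+
qed

text \<open>
  Kalton's gliding hump. If no finite set works, then for every finite \<open>E\<close> some \<open>\<mu>\<close> in \<open>\<Gamma>\<close> is large on
  a Lipschitz function that vanishes near \<open>E\<close>. Since \<open>\<mu>\<close> is almost a finite combination of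
  evaluations, it is still large on the part of that function close to a larger finite set \<open>E'\<close>.
  Repeating this with \<open>E'\<close> for \<open>E\<close> gives uniformly Lipschitz functions with disjoint supports on
  which \<open>\<Gamma>\<close> is not small, against \<open>Vstar_set_small_if_bounded_sums\<close>.
\<close>

lemma Vstar_set_concentrated:
  fixes z :: "'a::metric_space"
  assumes \<Gamma>: "Vstar_set (free_space UNIV z) (free_norm UNIV z) \<Gamma>"
    and d: "0 < d" and e: "0 < e"
  obtains E where "finite E" "z \<in> E"
    "\<And>\<mu> f. \<mu> \<in> \<Gamma> \<Longrightarrow> f \<in> Lip0 UNIV z \<Longrightarrow>
       \<bar>\<mu> f - \<mu> (cutoff z d 2 (\<lambda>x. infdist x E) * f)\<bar> \<le> e * Lip_const UNIV f"
proof -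
  let ?L = "Lip0 UNIV z"
  let ?inner = "\<lambda>E. cutoff z d 1 (\<lambda>x. infdist x E)"
  let ?outer = "\<lambda>E. cutoff z d 2 (\<lambda>x. infdist x E)"
  interpret L: gauged_subspace ?L "Lip_const UNIV" by (rule gauged_Lip0)
  interpret F: gauged_subspace "free_space UNIV z" "free_norm UNIV z"
    by (rule gauged_free_space) simp
  define C where "C = 1 + 2 / d"
  have C: "0 \<le> C" using d by (simp add: C_def)
  define B where "B = C * (1 + C)"
  have \<Gamma>F: "\<Gamma> \<subseteq> free_space UNIV z" using \<Gamma> by (simp add: Vstar_set_def)
  have inner: "Lip_multiplier UNIV UNIV z C (?inner E)"
    and outer: "Lip_multiplier UNIV UNIV z C (?outer E)" if "z \<in> E" for E
    unfolding C_def by (rule Lip_multiplier_cutoff_infdist[OF d that])+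
  have "\<exists>E. finite E \<and> z \<in> E \<and>
      (\<forall>\<mu>\<in>\<Gamma>. \<forall>f\<in>?L. Lip_const UNIV f \<le> 1 \<longrightarrow> \<bar>\<mu> f - \<mu> (?outer E * f)\<bar> \<le> e)"
  proof (rule ccontr)
    assume contra: "\<not> ?thesis"
    \<comment> \<open>The two cutoffs change on either side of this boundary: the inner one vanishes outside
        \<open>D E\<close>, the outer one is \<open>1\<close> on it.\<close>
    define D where "D E x \<longleftrightarrow> infdist x E < d * (1 + dist x z)" for E x
    have step: "\<exists>E' F. (finite E' \<and> E \<subseteq> E' \<and> F \<in> ?L \<and> Lip_const UNIV F \<le> B \<and>
        (\<exists>\<mu>\<in>\<Gamma>. e / 2 < \<bar>\<mu> F\<bar>) \<and> (\<forall>x. F x \<noteq> 0 \<longrightarrow> D E' x \<and> \<not> D E x))"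
      if E: "finite E" "z \<in> E" for E
    proof -
      have "\<not> (\<forall>\<mu>\<in>\<Gamma>. \<forall>f\<in>?L. Lip_const UNIV f \<le> 1 \<longrightarrow> \<bar>\<mu> f - \<mu> (?outer E * f)\<bar> \<le> e)"
        using contra E by blast
      then obtain \<mu> f where \<mu>: "\<mu> \<in> \<Gamma>" and f: "f \<in> ?L" "Lip_const UNIV f \<le> 1"
        and big: "e < \<bar>\<mu> f - \<mu> (?outer E * f)\<bar>"
        by (auto simp: not_le)
      have \<mu>F: "\<mu> \<in> free_space UNIV z" using \<mu> \<Gamma>F by blast
      define u where "u = (1 - ?outer E) * f"
      have m: "Lip_multiplier UNIV UNIV z (1 + C) (1 - ?outer E)"
        by (rule Lip_multiplier_diff[OF Lip_multiplier_one outer[OF E(2)]])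
      have u: "u \<in> ?L" unfolding u_def by (rule Lip_multiplierD(2)[OF m f(1)])
      have "Lip_const UNIV u \<le> (1 + C) * Lip_const UNIV f"
        unfolding u_def by (rule Lip_multiplierD(3)[OF m f(1)])
      also have "\<dots> \<le> (1 + C) * 1" using C by (intro mult_left_mono f(2)) simp
      finally have uC: "Lip_const UNIV u \<le> 1 + C" by simp
      have "u = f - ?outer E * f" by (simp add: u_def fun_eq_iff algebra_simps)
      then have \<mu>u: "e < \<bar>\<mu> u\<bar>"
        using big Lip0_functional_diff[OF free_space_functional[OF \<mu>F] f(1)]
          Lip_multiplierD(2)[OF outer[OF E(2)] f(1)] by simp
      \<comment> \<open>\<open>u\<close> and the function \<open>F\<close> below have Lipschitz constants at most \<open>1 + C\<close> and \<open>C * (1 + C)\<close>, which add up to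
          \<open>(1 + C) * (1 + C)\<close>.\<close>
      define r where "r = e / (2 * ((1 + C) * (1 + C)))"
      have r: "0 < r" using e C by (simp add: r_def)
      obtain \<nu> where \<nu>: "\<nu> \<in> span (delta UNIV z ` UNIV)"
        "\<And>f. f \<in> ?L \<Longrightarrow> \<bar>\<mu> f - \<nu> f\<bar> \<le> r * Lip_const UNIV f"
        using free_space_approx[OF UNIV_I \<mu>F r] by blast
      obtain E1 where E1: "finite E1" "E1 \<subseteq> UNIV"
        "\<forall>f\<in>?L. \<forall>g\<in>?L. (\<forall>x\<in>E1. f x = g x) \<longrightarrow> \<nu> f = \<nu> g"
        by (rule span_delta_finite_support[OF \<nu>(1)])
      let ?E' = "E \<union> E1"
      have zE': "z \<in> ?E'" using E(2) by blast
      define F where "F = ?inner ?E' * u"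
      have F: "F \<in> ?L" unfolding F_def by (rule Lip_multiplierD(2)[OF inner[OF zE'] u])
      have "Lip_const UNIV F \<le> C * Lip_const UNIV u"
        unfolding F_def by (rule Lip_multiplierD(3)[OF inner[OF zE'] u])
      also have "\<dots> \<le> B" unfolding B_def by (rule mult_left_mono[OF uC C])
      finally have FB: "Lip_const UNIV F \<le> B" .
      have "\<nu> F = \<nu> u"
      proof (rule E1(3)[rule_format, OF F u])
        fix x assume "x \<in> E1"
        then have "?inner ?E' x = 1" by (simp add: cutoff_eq_1_iff[OF d])
        then show "F x = u x" by (simp add: F_def)
      qed
      then have "\<bar>\<mu> u\<bar> - \<bar>\<mu> F\<bar> \<le> r * Lip_const UNIV u + r * Lip_const UNIV F"
        using \<nu>(2)[OF F] \<nu>(2)[OF u] by linarith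
      also have "\<dots> = r * (Lip_const UNIV u + Lip_const UNIV F)" by (simp add: algebra_simps)
      also have "\<dots> \<le> r * ((1 + C) + B)" using r uC FB by (intro mult_left_mono) auto
      also have "(1 + C) + B = (1 + C) * (1 + C)" by (simp add: B_def algebra_simps)
      also have "r * ((1 + C) * (1 + C)) = e / 2" using C by (simp add: r_def)
      finally have "e / 2 < \<bar>\<mu> F\<bar>" using \<mu>u by linarith
      moreover have "D ?E' x \<and> \<not> D E x" if "F x \<noteq> 0" for x
      proof
        have "?inner ?E' x \<noteq> 0" "?outer E x \<noteq> 1" using that by (auto simp: F_def u_def)
        then show "D ?E' x" "\<not> D E x"
          unfolding cutoff_eq_0_iff[OF d] cutoff_eq_1_iff[OF d] by (auto simp: D_def)
      qed
      ultimately show ?thesis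
        using E(1) E1(1) F FB \<mu> by (intro exI[of _ ?E'] exI[of _ F]) auto
    qed
    then obtain next_set hump where next_hump:
      "\<And>E. finite E \<Longrightarrow> z \<in> E \<Longrightarrow> finite (next_set E) \<and> E \<subseteq> next_set E \<and> hump E \<in> ?L \<and>
        Lip_const UNIV (hump E) \<le> B \<and> (\<exists>\<mu>\<in>\<Gamma>. e / 2 < \<bar>\<mu> (hump E)\<bar>) \<and>
        (\<forall>x. hump E x \<noteq> 0 \<longrightarrow> D (next_set E) x \<and> \<not> D E x)"
      by metis
    define Es where "Es k = (next_set ^^ k) {z}" for k
    have Es: "finite (Es k) \<and> z \<in> Es k" for k
      by (induction k) (use next_hump in \<open>auto simp: Es_def\<close>)
    define F where "F k = hump (Es k)" for k
    have Es_Suc: "Es (Suc k) = next_set (Es k)" for k by (simp add: Es_def)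
    note nh = next_hump[OF conjunct1[OF Es] conjunct2[OF Es], folded F_def Es_Suc]
    have mono: "Es i \<subseteq> Es j" if "i \<le> j" for i j
      using that by (rule lift_Suc_mono_le[of Es, rotated]) (use nh in blast)
    have disj: "F i x = 0 \<or> F j x = 0" if ij: "i < j" for i j x
    proof (rule ccontr)
      assume "\<not> ?thesis"
      then have "D (Es (Suc i)) x" "\<not> D (Es j) x" using nh by blast+
      moreover have "infdist x (Es j) \<le> infdist x (Es (Suc i))"
        using mono[of "Suc i" j] ij Es[of "Suc i"] by (intro infdist_mono) auto
      ultimately show False by (simp add: D_def)
    qed
    have disj': "F i x = 0 \<or> F j x = 0" if "i \<noteq> j" for i j x
      using disj[of i j x] disj[of j i x] that by linarith
    have "Lip_const UNIV (\<Sum>k<m. s k *\<^sub>R F k) \<le> 2 * B"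
      if "\<And>k. \<bar>s k\<bar> \<le> 1" for m and s :: "nat \<Rightarrow> real"
      by (rule Lip_const_disjoint_sum[of F UNIV z B]) (use nh disj' that in auto)
    then obtain k where "\<And>\<mu>. \<mu> \<in> \<Gamma> \<Longrightarrow> \<bar>\<mu> (F k)\<bar> \<le> e / 2"
      using Vstar_set_small_if_bounded_sums[OF UNIV_I \<Gamma>, of F "2 * B" "e / 2"] nh e by auto
    then show False using nh[of k] by force
  qed
  then obtain E where E: "finite E" "z \<in> E"
    and close: "\<And>\<mu> f. \<mu> \<in> \<Gamma> \<Longrightarrow> f \<in> ?L \<Longrightarrow> Lip_const UNIV f \<le> 1 \<Longrightarrow>
      \<bar>\<mu> f - \<mu> (?outer E * f)\<bar> \<le> e" by blast
  show ?thesis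
  proof (rule that[OF E])
    fix \<mu> f assume \<mu>: "\<mu> \<in> \<Gamma>" and f: "f \<in> ?L"
    have \<mu>F: "\<mu> \<in> free_space UNIV z" using \<mu> \<Gamma>F by blast
    let ?\<kappa> = "\<mu> - mulop UNIV z (?outer E) \<mu>"
    have \<kappa>: "?\<kappa> \<in> free_space UNIV z"
      by (intro subspace_diff[OF F.subspace] \<mu>F mulop_free_space[OF _ _ outer[OF E(2)]]) auto
    have "\<bar>?\<kappa> f\<bar> \<le> free_norm UNIV z ?\<kappa> * Lip_const UNIV f"
      by (rule free_norm_bound[OF \<kappa> f])
    also have "\<dots> \<le> e * Lip_const UNIV f"
    proof (rule mult_right_mono[OF _ Lip_const_nonneg[OF f]])
      show "free_norm UNIV z ?\<kappa> \<le> e"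
        unfolding free_norm_def
        by (rule L.dual_norm_le) (use close[OF \<mu>] in \<open>simp add: mulop_def\<close>)
    qed
    finally show "\<bar>\<mu> f - \<mu> (?outer E * f)\<bar> \<le> e * Lip_const UNIV f"
      using f by (simp add: mulop_def)
  qed
qed

section \<open>Tightness of (V*)-sets\<close>

lemma infdist_less_imp:
  assumes "infdist x E < r" "E \<noteq> {}"
  obtains a where "a \<in> E" "dist x a < r"
  using assms by (auto simp: infdist_notempty cINF_less_iff intro!: bdd_belowI2[of _ 0])

text \<open>
  This is Kuratowski's intersection theorem: the sets \<open>A n\<close> shrink towards the compact intersection
  \<open>K\<close> of their closures. Points \<open>x n \<in> A n\<close> outside a finite cover of \<open>K\<close> would have a limit point,
  which lies in \<open>K\<close> but not in the cover.
\<close>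

lemma decreasing_totally_bounded_cover:
  fixes A :: "nat \<Rightarrow> 'a::complete_space set" and B :: "'a \<Rightarrow> 'a set"
  assumes dec: "\<And>m n. m \<le> n \<Longrightarrow> A n \<subseteq> A m"
    and tb: "\<And>e. 0 < e \<Longrightarrow> \<exists>n P. finite P \<and> A n \<subseteq> (\<Union>p\<in>P. ball p e)"
    and B: "\<And>p. open (B p)" "\<And>p. p \<in> B p"
  obtains n P where "finite P" "A n \<subseteq> (\<Union>p\<in>P. B p)"
proof -
  \<comment> \<open>A set that is almost contained in every \<open>A n\<close> is totally bounded; this is applied to the
      range of a sequence with \<open>x n \<in> A n\<close>.\<close>
  have sub_tb: "\<exists>P. finite P \<and> closure S \<subseteq> (\<Union>p\<in>P. ball p e)"
    if S: "\<And>n. finite (S - A n)" and e: "0 < e" for S e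
  proof -
    obtain n P where P: "finite P" "A n \<subseteq> (\<Union>p\<in>P. ball p (e / 2))"
      using tb[of "e / 2"] e by auto
    let ?Q = "P \<union> (S - A n)"
    have "S \<subseteq> (\<Union>p\<in>?Q. cball p (e / 2))"
    proof
      fix x assume "x \<in> S"
      then show "x \<in> (\<Union>p\<in>?Q. cball p (e / 2))"
        using P(2) e by (cases "x \<in> A n") (force, auto intro!: bexI[of _ x])
    qed
    moreover have "closed (\<Union>p\<in>?Q. cball p (e / 2))"
      using P(1) S by (intro closed_UN) auto
    ultimately have "closure S \<subseteq> (\<Union>p\<in>?Q. cball p (e / 2))" by (rule closure_minimal)
    also have "\<dots> \<subseteq> (\<Union>p\<in>?Q. ball p e)" using e by force
    finally have "closure S \<subseteq> (\<Union>p\<in>?Q. ball p e)" .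
    moreover have "finite ?Q" using P(1) S by simp
    ultimately show ?thesis by (intro exI[of _ ?Q] conjI)
  qed
  have compact: "compact (closure S)" if "\<And>n. finite (S - A n)" for S
    unfolding compact_eq_totally_bounded
    using sub_tb[OF that] by (auto simp: complete_eq_closed)
  define K where "K = (\<Inter>n. closure (A n))"
  have "compact K"
    unfolding compact_eq_totally_bounded
  proof (intro conjI allI impI)
    show "complete K" by (auto simp: complete_eq_closed K_def)
    fix e :: real assume e: "0 < e"
    obtain n P where P: "finite P" "A n \<subseteq> (\<Union>p\<in>P. ball p (e / 2))"
      using tb[of "e / 2"] e by auto
    have "closure (A n) \<subseteq> (\<Union>p\<in>P. cball p (e / 2))"
      using P by (intro closure_minimal closed_UN) (auto, force)
    also have "\<dots> \<subseteq> (\<Union>p\<in>P. ball p e)" using e by force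
    finally have "K \<subseteq> (\<Union>p\<in>P. ball p e)" unfolding K_def by blast
    with P(1) show "\<exists>P. finite P \<and> K \<subseteq> (\<Union>p\<in>P. ball p e)" by (intro exI[of _ P] conjI)
  qed
  then obtain P where P: "finite P" "K \<subseteq> (\<Union>p\<in>P. B p)"
  proof (rule compactE_image[of K UNIV B])
    show "K \<subseteq> (\<Union>p\<in>UNIV. B p)" using B(2) by blast
  qed (use B(1) in auto)
  let ?G = "\<Union>p\<in>P. B p"
  have "\<exists>n. A n \<subseteq> ?G"
  proof (rule ccontr)
    assume "\<not> ?thesis"
    then have "\<forall>n. \<exists>x. x \<in> A n - ?G" by blast
    then obtain x where x: "\<And>n. x n \<in> A n - ?G" by metis
    have "range x - A n \<subseteq> x ` {..<n}" for n
    proof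
      fix y assume "y \<in> range x - A n"
      then obtain k where k: "y = x k" "x k \<notin> A n" by blast
      with x[of k] dec[of n k] have "k < n" by (metis DiffD1 not_le subsetD)
      with k(1) show "y \<in> x ` {..<n}" by blast
    qed
    then have "finite (range x - A n)" for n by (rule finite_subset) simp
    then have "seq_compact (closure (range x))" using compact by (simp add: compact_imp_seq_compact)
    moreover have "x n \<in> closure (range x)" for n by (simp add: closure_subset[THEN subsetD])
    ultimately obtain l r where l: "strict_mono r" "(x \<circ> r) \<longlonglongrightarrow> l"
      unfolding seq_compact_def by metis
    have "l \<in> closure (A n)" for n
    proof (rule Lim_in_closed_set[OF closed_closure _ _ l(2)])
      have "(x \<circ> r) k \<in> closure (A n)" if "n \<le> k" for k
      proof -
        have "n \<le> r k" using seq_suble[OF l(1), of k] that by linarith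
        with x[of "r k"] dec[of n "r k"] closure_subset[of "A n"] show ?thesis by auto
      qed
      then show "\<forall>\<^sub>F k in sequentially. (x \<circ> r) k \<in> closure (A n)"
        unfolding eventually_sequentially by blast
    qed simp
    then have "l \<in> K" by (simp add: K_def)
    with P(2) have "l \<in> ?G" by blast
    moreover have "l \<in> - ?G"
    proof (rule Lim_in_closed_set[OF _ _ _ l(2)])
      show "closed (- ?G)" using B(1) by (intro closed_Compl open_UN) auto
      show "\<forall>\<^sub>F k in sequentially. (x \<circ> r) k \<in> - ?G" using x by auto
    qed simp
    ultimately show False by blast
  qed
  with P(1) show ?thesis using that by blast
qed

lemma abs_diff_le_trans:
  assumes "\<bar>a - b\<bar> \<le> c * L" "\<bar>b - d\<bar> \<le> c' * L" "c + c' = c''"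
  shows "\<bar>a - d\<bar> \<le> c'' * (L::real)"
  using assms by (auto simp: algebra_simps simp flip: assms(3))

text \<open>
  Concentration gives only neighbourhoods of finite sets of a given relative size, while the sets
  \<open>B p\<close> may be arbitrarily small. Applying it again and again, to the (V*)-set already cut off, with
  relative sizes tending to \<open>0\<close> and errors \<open>e / 2 ^ Suc n\<close>, gives decreasing supports to which
  \<open>decreasing_totally_bounded_cover\<close> applies. So finitely many steps lead into a finite union of
  the \<open>B p\<close>.
\<close>

lemma Vstar_set_tight:
  fixes z :: "'a::complete_space"
  assumes \<Gamma>: "Vstar_set (free_space UNIV z) (free_norm UNIV z) \<Gamma>"
    and e: "0 < e" and B: "\<And>p. open (B p)" "\<And>p. p \<in> B p"
  obtains H K P where "Lip_multiplier UNIV UNIV z K H" "finite P" "{x. H x \<noteq> 0} \<subseteq> (\<Union>p\<in>P. B p)"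
    "\<And>\<mu> f. \<mu> \<in> \<Gamma> \<Longrightarrow> f \<in> Lip0 UNIV z \<Longrightarrow> \<bar>\<mu> f - \<mu> (H * f)\<bar> \<le> e * Lip_const UNIV f"
proof -
  let ?L = "Lip0 UNIV z"
  define d where "d n = 1 / (4 * (real n + 1))" for n
  have d: "0 < d n" for n by (simp add: d_def)
  define close where "close c h h' \<longleftrightarrow>
    (\<forall>\<mu>\<in>\<Gamma>. \<forall>f\<in>?L. \<bar>\<mu> (h * f) - \<mu> (h' * f)\<bar> \<le> c * Lip_const UNIV f)" for c h h'
  define near where "near n E x \<longleftrightarrow> infdist x E < 2 * (d n * (1 + dist x z))" for n E x
  have "\<exists>H. \<forall>n. ((\<exists>K. Lip_multiplier UNIV UNIV z K (H n)) \<and> (n = 0 \<longrightarrow> H n = 1)) \<and>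
      ((\<exists>E. finite E \<and> z \<in> E \<and> (\<forall>x. H (Suc n) x \<noteq> 0 \<longrightarrow> H n x \<noteq> 0 \<and> near n E x)) \<and>
      close (e / 2 ^ Suc n) (H n) (H (Suc n)))"
  proof (rule dependent_nat_choice[where
        P = "\<lambda>n h. (\<exists>K. Lip_multiplier UNIV UNIV z K h) \<and> (n = 0 \<longrightarrow> h = 1)" and
        Q = "\<lambda>n h h'. (\<exists>E. finite E \<and> z \<in> E \<and> (\<forall>x. h' x \<noteq> 0 \<longrightarrow> h x \<noteq> 0 \<and> near n E x)) \<and>
          close (e / 2 ^ Suc n) h h'"])
      show "\<exists>h. (\<exists>K. Lip_multiplier UNIV UNIV z K h) \<and> ((0::nat) = 0 \<longrightarrow> h = 1)"
        using Lip_multiplier_one by blast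
    next
      fix h and n :: nat assume "(\<exists>K. Lip_multiplier UNIV UNIV z K h) \<and> (n = 0 \<longrightarrow> h = 1)"
      then obtain K where h: "Lip_multiplier UNIV UNIV z K h" by blast
      obtain E where E: "finite E" "z \<in> E" and
        c: "\<And>\<mu> f. \<mu> \<in> mulop UNIV z h ` \<Gamma> \<Longrightarrow> f \<in> ?L \<Longrightarrow>
         \<bar>\<mu> f - \<mu> (cutoff z (d n) 2 (\<lambda>x. infdist x E) * f)\<bar> \<le> (e / 2 ^ Suc n) * Lip_const UNIV f"
        using Vstar_set_concentrated[OF mulop_Vstar_set[OF UNIV_I UNIV_I h \<Gamma>] d, of "e / 2 ^ Suc n"] e
        by (metis divide_pos_pos zero_less_numeral zero_less_power)
      define g where "g = cutoff z (d n) 2 (\<lambda>x. infdist x E)"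
      have g: "Lip_multiplier UNIV UNIV z (1 + 2 / d n) g"
        unfolding g_def by (rule Lip_multiplier_cutoff_infdist[OF d E(2)])
      have "close (e / 2 ^ Suc n) h (h * g)"
        unfolding close_def
      proof (intro ballI)
        fix \<mu> f assume "\<mu> \<in> \<Gamma>" "f \<in> ?L"
        then show "\<bar>\<mu> (h * f) - \<mu> (h * g * f)\<bar> \<le> e / 2 ^ Suc n * Lip_const UNIV f"
          using c[OF imageI, of \<mu> f] Lip_multiplierD(2)[OF g]
          by (simp add: mulop_def mult.assoc flip: g_def)
      qed
      moreover have "h x \<noteq> 0 \<and> near n E x" if "(h * g) x \<noteq> 0" for x
      proof -
        have "h x \<noteq> 0" "g x \<noteq> 0" using that by auto
        then show ?thesis unfolding g_def cutoff_eq_0_iff[OF d] by (simp add: near_def)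
      qed
      ultimately show "\<exists>h'. ((\<exists>K. Lip_multiplier UNIV UNIV z K h') \<and> (Suc n = 0 \<longrightarrow> h' = 1)) \<and>
          (\<exists>E. finite E \<and> z \<in> E \<and> (\<forall>x. h' x \<noteq> 0 \<longrightarrow> h x \<noteq> 0 \<and> near n E x)) \<and>
          close (e / 2 ^ Suc n) h h'"
        using E Lip_multiplier_mult[OF g h] by (intro exI[of _ "h * g"]) blast
  qed
  then obtain H where H: "\<And>n. \<exists>K. Lip_multiplier UNIV UNIV z K (H n)" "H 0 = 1"
    "\<And>n. \<exists>E. finite E \<and> z \<in> E \<and> (\<forall>x. H (Suc n) x \<noteq> 0 \<longrightarrow> H n x \<noteq> 0 \<and> near n E x)"
    "\<And>n. close (e / 2 ^ Suc n) (H n) (H (Suc n))" by blast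
  define A where "A n = {x. H n x \<noteq> 0}" for n
  obtain E where E: "\<And>n. finite (E n)" "\<And>n. z \<in> E n"
    "\<And>n x. x \<in> A (Suc n) \<Longrightarrow> x \<in> A n \<and> near n (E n) x"
    using H(3) unfolding A_def mem_Collect_eq by metis
  have dec: "A n \<subseteq> A m" if "m \<le> n" for m n
    using that by (rule lift_Suc_antimono_le[of A, rotated]) (use E(3) in blast)
  \<comment> \<open>The first step, with relative size \<open>2 * d 0 = 1 / 2 < 1\<close>, already makes the support bounded. From
      then on the relative sizes are absolute sizes up to the factor \<open>R\<close>.\<close>
  obtain R where R: "\<And>x. x \<in> A 1 \<Longrightarrow> 1 + dist x z \<le> R"
  proof -
    define M where "M = Max ((\<lambda>a. dist a z) ` E 0)"
    have M: "dist a z \<le> M" if "a \<in> E 0" for a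
      unfolding M_def using E(1)[of 0] that by (intro Max_ge) auto
    show ?thesis
    proof (rule that)
      fix x assume "x \<in> A 1"
      then have "infdist x (E 0) < 2 * (d 0 * (1 + dist x z))"
        using E(3)[of x 0] by (simp add: near_def)
      then obtain a where a: "a \<in> E 0" "dist x a < 2 * (d 0 * (1 + dist x z))"
        using infdist_less_imp E(2)[of 0] by blast
      have "dist x a < (1 + dist x z) / 2" using a(2) by (simp add: d_def)
      moreover have "dist x z \<le> dist x a + dist a z" by (rule dist_triangle)
      ultimately show "1 + dist x z \<le> 2 * (1 + M)" using M[OF a(1)] by (simp add: field_simps)
    qed
  qed
  have tb: "\<exists>n P. finite P \<and> A n \<subseteq> (\<Union>p\<in>P. ball p r)" if r: "0 < r" for r
  proof -
    obtain n where n: "R / (2 * r) < real n" using reals_Archimedean2 by blast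
    let ?n = "Suc (Suc n)"
    have "A ?n \<subseteq> (\<Union>p\<in>E (Suc n). ball p r)"
    proof
      fix x assume x: "x \<in> A ?n"
      then have "infdist x (E (Suc n)) < 2 * (d (Suc n) * (1 + dist x z))"
        using E(3) by (simp add: near_def)
      then obtain a where a: "a \<in> E (Suc n)" "dist x a < 2 * (d (Suc n) * (1 + dist x z))"
        using infdist_less_imp E(2) by blast
      have "x \<in> A 1" using dec[of 1 ?n] x by auto
      then have "2 * (d (Suc n) * (1 + dist x z)) \<le> 2 * (d (Suc n) * R)"
        using R d[of "Suc n"] by (intro mult_left_mono) auto
      also have "\<dots> \<le> r"
      proof -
        have "R \<le> 2 * r * real n" using n r by (simp add: field_simps)
        also have "\<dots> \<le> 2 * r * (real n + 2)" using r by simp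
        finally show ?thesis by (simp add: d_def field_simps)
      qed
      finally have "dist a x < r" using a(2) by (simp add: dist_commute)
      with a(1) show "x \<in> (\<Union>p\<in>E (Suc n). ball p r)" by auto
    qed
    then show ?thesis using E(1) by blast
  qed
  obtain n P where nP: "finite P" "A n \<subseteq> (\<Union>p\<in>P. B p)"
    by (rule decreasing_totally_bounded_cover[of A B, OF dec tb B]) (assumption | rule that)+
  have close_1: "close (e * (1 - 1 / 2 ^ n)) 1 (H n)" for n
  proof (induction n)
    case 0
    then show ?case by (simp add: close_def H(2))
  next
    case (Suc n)
    have eq: "e * (1 - 1 / 2 ^ n) + e / 2 ^ Suc n = e * (1 - 1 / 2 ^ Suc n)"
      by (simp add: field_simps)
    show ?case
      unfolding close_def
    proof (intro ballI)
      fix \<mu> f assume "\<mu> \<in> \<Gamma>" "f \<in> ?L"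
      with Suc H(4)[of n] show
        "\<bar>\<mu> (1 * f) - \<mu> (H (Suc n) * f)\<bar> \<le> e * (1 - 1 / 2 ^ Suc n) * Lip_const UNIV f"
        unfolding close_def by (intro abs_diff_le_trans[OF _ _ eq]) blast+
    qed
  qed
  obtain K where K: "Lip_multiplier UNIV UNIV z K (H n)" using H(1) by blast
  show ?thesis
  proof (rule that[OF K nP(1)])
    show "{x. H n x \<noteq> 0} \<subseteq> (\<Union>p\<in>P. B p)" using nP(2) by (simp add: A_def)
    fix \<mu> f assume \<mu>: "\<mu> \<in> \<Gamma>" and f: "f \<in> ?L"
    have "\<bar>\<mu> f - \<mu> (H n * f)\<bar> \<le> e * (1 - 1 / 2 ^ n) * Lip_const UNIV f"
      using close_1[of n] \<mu> f by (simp add: close_def)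
    also have "\<dots> \<le> e * 1 * Lip_const UNIV f"
      using e Lip_const_nonneg[OF f] by (intro mult_right_mono mult_left_mono) auto
    finally show "\<bar>\<mu> f - \<mu> (H n * f)\<bar> \<le> e * Lip_const UNIV f" by simp
  qed
qed

section \<open>Pointwise limits of (V*)-sets\<close>

lemma compact_imp_closed_fun:
  fixes S :: "('b \<Rightarrow> real) set"
  assumes "compact S"
  shows "closed S"
proof -
  have "Hausdorff_space (product_topology (\<lambda>_::'b. euclideanreal) UNIV)"
    by (simp add: Hausdorff_space_product_topology)
  then have "Hausdorff_space (euclidean :: ('b \<Rightarrow> real) topology)"
    by (simp only: euclidean_product_topology)
  from compactin_imp_closedin[OF this] assms show ?thesis by simp
qed

text \<open>
  Tychonoff's theorem.
\<close>

lemma compact_closure_if_pointwise_bounded: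
  fixes S :: "('b \<Rightarrow> real) set"
  assumes "\<And>f. \<exists>B. \<forall>\<mu>\<in>S. \<bar>\<mu> f\<bar> \<le> B"
  shows "compact (closure S)"
proof -
  obtain B where B: "\<And>f \<mu>. \<mu> \<in> S \<Longrightarrow> \<bar>\<mu> f\<bar> \<le> B f" using assms by metis
  let ?C = "PiE UNIV (\<lambda>f. {- B f..B f})"
  have "compactin (product_topology (\<lambda>_. euclidean) UNIV) ?C"
    unfolding compactin_PiE by simp
  then have C: "compact ?C" by (simp add: euclidean_product_topology)
  have "S \<subseteq> ?C" using B by (auto simp: abs_le_iff PiE_def) (metis minus_le_iff)
  then have "closure S \<subseteq> ?C" by (rule closure_minimal) (rule compact_imp_closed_fun[OF C])
  then have "?C \<inter> closure S = closure S" by blast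
  then show ?thesis using compact_Int_closed[OF C closed_closure, of S] by simp
qed

lemma Lip0_functional_closure:
  assumes "\<And>\<mu>. \<mu> \<in> \<Gamma> \<Longrightarrow> Lip0_functional N z \<mu>" "\<theta> \<in> closure \<Gamma>"
  shows "Lip0_functional N z \<theta>"
proof -
  have "closed {\<mu> :: ('a \<Rightarrow> real) \<Rightarrow> real. Lip0_functional N z \<mu>}"
    unfolding Lip0_functional_def Ball_def
    by (intro closed_Collect_conj closed_Collect_all closed_Collect_imp closed_Collect_eq
        continuous_intros continuous_on_product_coordinates open_Collect_const)
  then have "closure \<Gamma> \<subseteq> {\<mu>. Lip0_functional N z \<mu>}"
    using assms(1) by (intro closure_minimal) auto
  with assms(2) show ?thesis by blast
qed

lemma closure_bound:
  fixes \<Gamma> :: "('b \<Rightarrow> real) set"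
  assumes "\<And>\<mu>. \<mu> \<in> \<Gamma> \<Longrightarrow> \<bar>\<mu> f - \<mu> g\<bar> \<le> c" "\<theta> \<in> closure \<Gamma>"
  shows "\<bar>\<theta> f - \<theta> g\<bar> \<le> c"
proof -
  have "closed {\<mu> :: 'b \<Rightarrow> real. \<bar>\<mu> f - \<mu> g\<bar> \<le> c}"
    by (intro closed_Collect_le continuous_intros continuous_on_product_coordinates)
  then have "closure \<Gamma> \<subseteq> {\<mu>. \<bar>\<mu> f - \<mu> g\<bar> \<le> c}"
    using assms(1) by (intro closure_minimal) auto
  with assms(2) show ?thesis by blast
qed

lemma mulop_closure:
  assumes "\<theta> \<in> closure \<Gamma>"
  shows "mulop N z h \<theta> \<in> closure (mulop N z h ` \<Gamma>)"
proof -
  have "continuous_on UNIV (\<lambda>\<mu>. mulop N z h \<mu> f)" for f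
    by (cases "f \<in> Lip0 N z") (auto simp: mulop_def)
  then have "continuous_on (closure \<Gamma>) (mulop N z h)"
    by (intro continuous_on_subset[OF continuous_on_coordinatewise_then_product]) auto
  from image_closure_subset[OF this closed_closure closure_subset] assms show ?thesis by blast
qed

lemma closure_subset_if_property_Vstar:
  assumes z: "z \<in> N" and V: "property_Vstar (free_space N z) (free_norm N z)"
    and \<Gamma>: "Vstar_set (free_space N z) (free_norm N z) \<Gamma>"
  shows "closure \<Gamma> \<subseteq> free_space N z"
proof -
  have sub: "\<Gamma> \<subseteq> free_space N z" using \<Gamma> by (simp add: Vstar_set_def)
  have "compact (free_space N z \<inter> closure \<Gamma>)"
    using V \<Gamma> weak_compactness_free_space[OF z sub] by (simp add: property_Vstar_def)
  then have "closure \<Gamma> \<subseteq> free_space N z \<inter> closure \<Gamma>"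
    using sub closure_subset by (intro closure_minimal compact_imp_closed_fun) auto
  then show ?thesis by blast
qed

text \<open>
  The cutoff \<open>h\<close> is chosen with support in \<open>U\<close>. It maps \<open>\<Gamma>\<close> to a (V*)-set of the free space over
  \<open>closure U \<union> {z}\<close>, whose closure stays in that space by property (V*). The inclusion of free
  spaces, which is multiplication by the indicator function, brings the limit back.
\<close>

lemma localized_limit_in_free_space:
  fixes z :: "'a::metric_space"
  assumes U: "p \<in> interior U"
    and V: "property_Vstar (free_space (closure U \<union> {z}) z) (free_norm (closure U \<union> {z}) z)"
    and \<Gamma>: "Vstar_set (free_space UNIV z) (free_norm UNIV z) \<Gamma>" and \<theta>: "\<theta> \<in> closure \<Gamma>"
  obtains d where "0 < d" "mulop UNIV z (cutoff z d 2 (\<lambda>x. dist x p)) \<theta> \<in> free_space UNIV z"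
proof -
  let ?N = "closure U \<union> {z}"
  obtain r where r: "0 < r" "ball p r \<subseteq> U"
    using U by (meson interior_subset mem_interior subset_trans)
  \<comment> \<open>If \<open>dist x p \<ge> r\<close>, then \<open>2 * d * (1 + dist x z) \<le> r / 2 + dist x p / 2 \<le> dist x p\<close>, so the cutoff
      vanishes at \<open>x\<close>.\<close>
  define d where "d = min (1 / 4) (r / (4 * (1 + dist p z)))"
  have pos: "0 < 1 + dist p z" by (simp add: add_pos_nonneg)
  have d: "0 < d" using r(1) pos by (simp add: d_def)
  have d4: "d \<le> 1 / 4" unfolding d_def by (rule min.cobounded1)
  define h where "h = cutoff z d 2 (\<lambda>x. dist x p)"
  have h: "Lip_multiplier UNIV UNIV z (1 + (2 + dist z p) / d) h"
    unfolding h_def by (rule Lip_multiplier_cutoff_dist[OF d])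
  have off: "h x = 0" if "x \<notin> ?N" for x
  proof -
    have "x \<notin> ball p r" using that r(2) closure_subset by blast
    then have far: "r \<le> dist x p" by (simp add: dist_commute)
    have "d * (1 + dist x z) \<le> d * (1 + dist p z) + d * dist x p"
      using d dist_triangle[of x z p] by (simp flip: distrib_left)
    also have "d * (1 + dist p z) \<le> r / (4 * (1 + dist p z)) * (1 + dist p z)"
      using pos by (intro mult_right_mono) (auto simp: d_def)
    also have "\<dots> = r / 4" using nonzero_mult_divide_mult_cancel_right[of "1 + dist p z" r 4] pos
      by simp
    also have "d * dist x p \<le> 1 / 4 * dist x p" by (intro mult_right_mono d4) simp
    finally show ?thesis using far by (simp add: h_def cutoff_eq_0_iff[OF d])
  qed
  have hN: "Lip_multiplier ?N UNIV z (1 + (2 + dist z p) / d) h"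
    by (rule Lip_multiplier_extend[OF _ h off]) simp_all
  have "Vstar_set (free_space ?N z) (free_norm ?N z) (mulop ?N z h ` \<Gamma>)"
    by (rule mulop_Vstar_set[OF _ _ hN \<Gamma>]) simp_all
  then have "closure (mulop ?N z h ` \<Gamma>) \<subseteq> free_space ?N z"
    by (intro closure_subset_if_property_Vstar[OF _ V]) simp
  then have "mulop ?N z h \<theta> \<in> free_space ?N z" using mulop_closure[OF \<theta>] by blast
  moreover have ind: "Lip_multiplier UNIV ?N z 1 (indicator ?N)"
    by (rule Lip_multiplier_indicator) simp
  ultimately have "mulop UNIV z (indicator ?N) (mulop ?N z h \<theta>) \<in> free_space UNIV z"
    by (intro mulop_free_space[OF _ _ ind]) simp_all
  moreover have "h * indicator ?N = h"
    using off by (auto simp: fun_eq_iff indicator_def)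
  ultimately have "mulop UNIV z h \<theta> \<in> free_space UNIV z"
    by (simp only: mulop_mulop[OF ind])
  then show ?thesis using that d unfolding h_def by blast
qed

text \<open>
  Let \<open>q\<close> be the product of the functions \<open>1 - h p\<close>. Expanding \<open>1 - q\<close> shows that multiplication by
  \<open>1 - q\<close> sends \<open>\<theta>\<close> to the free space. Since \<open>q\<close> vanishes on the support of \<open>H\<close>,
  it holds that \<open>H = H * (1 - q)\<close>, and multiplication by \<open>H\<close> preserves the free space.
\<close>

lemma patch_localized_limits:
  assumes "finite P" and h: "\<And>p. p \<in> P \<Longrightarrow> Lip_multiplier UNIV UNIV z (k p) (h p)"
    and \<theta>: "Lip0_functional UNIV z \<theta>"
    and loc: "\<And>p. p \<in> P \<Longrightarrow> mulop UNIV z (h p) \<theta> \<in> free_space UNIV z"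
    and H: "Lip_multiplier UNIV UNIV z K H" and cover: "\<And>x. H x \<noteq> 0 \<Longrightarrow> \<exists>p\<in>P. h p x = 1"
  shows "mulop UNIV z H \<theta> \<in> free_space UNIV z"
proof -
  note sub = subspace_free_space[OF UNIV_I]
  have "\<exists>q L. Lip_multiplier UNIV UNIV z L q \<and> \<theta> - mulop UNIV z q \<theta> \<in> free_space UNIV z \<and>
      (\<forall>p\<in>P. \<forall>x. h p x = 1 \<longrightarrow> q x = 0)"
    using assms(1) h loc
  proof (induction P rule: finite_induct)
    case empty
    have "\<theta> - mulop UNIV z 1 \<theta> = 0" by (simp add: mulop_one[OF \<theta>])
    then have "\<theta> - mulop UNIV z 1 \<theta> \<in> free_space UNIV z" using subspace_0[OF sub] by simp
    then show ?case using Lip_multiplier_one by blast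
  next
    case (insert p P)
    have "\<exists>q L. Lip_multiplier UNIV UNIV z L q \<and> \<theta> - mulop UNIV z q \<theta> \<in> free_space UNIV z \<and>
        (\<forall>p\<in>P. \<forall>x. h p x = 1 \<longrightarrow> q x = 0)"
      by (rule insert.IH) (use insert.prems in blast)+
    then obtain q L where q: "Lip_multiplier UNIV UNIV z L q"
      "\<theta> - mulop UNIV z q \<theta> \<in> free_space UNIV z" "\<forall>p\<in>P. \<forall>x. h p x = 1 \<longrightarrow> q x = 0" by blast
    have hp: "Lip_multiplier UNIV UNIV z (k p) (h p)" using insert.prems by simp
    let ?q = "q - h p * q"
    note hq = Lip_multiplier_mult[OF q(1) hp]
    have "mulop UNIV z q (mulop UNIV z (h p) \<theta>) \<in> free_space UNIV z"
      using insert.prems by (intro mulop_free_space[OF _ _ q(1)]) auto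
    then have "mulop UNIV z (h p * q) \<theta> \<in> free_space UNIV z" by (simp only: mulop_mulop[OF q(1)])
    then have "(\<theta> - mulop UNIV z q \<theta>) + mulop UNIV z (h p * q) \<theta> \<in> free_space UNIV z"
      by (rule subspace_add[OF sub q(2)])
    moreover have "(\<theta> - mulop UNIV z q \<theta>) + mulop UNIV z (h p * q) \<theta> = \<theta> - mulop UNIV z ?q \<theta>"
      unfolding mulop_diff[OF q(1) hq \<theta>] by simp
    ultimately have "\<theta> - mulop UNIV z ?q \<theta> \<in> free_space UNIV z" by simp
    moreover have "\<forall>p'\<in>insert p P. \<forall>x. h p' x = 1 \<longrightarrow> ?q x = 0" using q(3) by auto
    ultimately show ?case using Lip_multiplier_diff[OF q(1) hq] by blast
  qed
  then obtain q L where q: "Lip_multiplier UNIV UNIV z L q"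
    "\<theta> - mulop UNIV z q \<theta> \<in> free_space UNIV z" "\<forall>p\<in>P. \<forall>x. h p x = 1 \<longrightarrow> q x = 0" by blast
  have "q x * H x = 0" for x using cover[of x] q(3) by auto
  then have qH: "q * H = 0" by (simp add: fun_eq_iff)
  have "\<theta> 0 = 0"
    using gauged_subspace.subspace[OF gauged_Lip0, of UNIV z] \<theta> Lip0_functional_diff[OF \<theta>, of 0 0]
    by (simp add: subspace_0)
  then have "mulop UNIV z (q * H) \<theta> = 0"
    unfolding qH by (intro ext) (simp add: mulop_def)
  then have "mulop UNIV z H (mulop UNIV z q \<theta>) = 0" by (simp only: mulop_mulop[OF H])
  moreover have "mulop UNIV z H (\<theta> - mulop UNIV z q \<theta>)
      = mulop UNIV z H \<theta> - mulop UNIV z H (mulop UNIV z q \<theta>)"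
    by (auto simp: mulop_def fun_eq_iff)
  ultimately have "mulop UNIV z H \<theta> = mulop UNIV z H (\<theta> - mulop UNIV z q \<theta>)" by simp
  also have "\<dots> \<in> free_space UNIV z" by (rule mulop_free_space[OF _ _ H q(2)]) simp_all
  finally show ?thesis .
qed

theorem theorem1:
  fixes z :: "'a::complete_space"
  assumes "\<And>x::'a. \<exists>U. x \<in> interior U \<and>
             property_Vstar (free_space (closure U \<union> {z}) z) (free_norm (closure U \<union> {z}) z)"
  shows "property_Vstar (free_space (UNIV :: 'a set) z) (free_norm UNIV z)"
  unfolding property_Vstar_def
proof (intro allI impI)
  fix \<Gamma> assume \<Gamma>: "Vstar_set (free_space (UNIV :: 'a set) z) (free_norm UNIV z) \<Gamma>"
  let ?V = "free_space (UNIV :: 'a set) z"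
  have \<Gamma>V: "\<Gamma> \<subseteq> ?V" using \<Gamma> by (simp add: Vstar_set_def)
  have functional: "Lip0_functional UNIV z \<mu>" if "\<mu> \<in> \<Gamma>" for \<mu>
    using that \<Gamma>V free_space_functional by blast
  have "closure \<Gamma> \<subseteq> ?V"
  proof
    fix \<theta> assume \<theta>: "\<theta> \<in> closure \<Gamma>"
    have \<theta>f: "Lip0_functional UNIV z \<theta>" by (rule Lip0_functional_closure[OF functional \<theta>])
    have "\<exists>d>0. mulop UNIV z (cutoff z d 2 (\<lambda>x. dist x p)) \<theta> \<in> ?V" for p
      using assms[of p] localized_limit_in_free_space[OF _ _ \<Gamma> \<theta>] by metis
    then obtain d where d: "\<And>p. 0 < d p"
      "\<And>p. mulop UNIV z (cutoff z (d p) 2 (\<lambda>x. dist x p)) \<theta> \<in> ?V" by metis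
    show "\<theta> \<in> ?V"
      unfolding free_space_iff[OF UNIV_I]
    proof (intro conjI allI impI)
      fix e :: real assume e: "0 < e"
      have centre: "p \<in> ball p (d p)" for p using d(1) by simp
      obtain H K P where H: "Lip_multiplier UNIV UNIV z K H" "finite P"
        "{x. H x \<noteq> 0} \<subseteq> (\<Union>p\<in>P. ball p (d p))"
        "\<And>\<mu> f. \<mu> \<in> \<Gamma> \<Longrightarrow> f \<in> Lip0 UNIV z \<Longrightarrow> \<bar>\<mu> f - \<mu> (H * f)\<bar> \<le> e / 2 * Lip_const UNIV f"
        by (rule Vstar_set_tight[where B = "\<lambda>p. ball p (d p)",
              OF \<Gamma> half_gt_zero[OF e] open_ball centre]) (rule that)
      have "mulop UNIV z H \<theta> \<in> ?V"
      proof (rule patch_localized_limits[OF H(2) Lip_multiplier_cutoff_dist[OF d(1)] \<theta>f d(2) H(1)])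
        fix x assume "H x \<noteq> 0"
        then obtain p where p: "p \<in> P" "dist x p < d p" using H(3) by (auto simp: dist_commute)
        have "d p * 1 \<le> d p * (1 + dist x z)" using d(1)[of p] by (intro mult_left_mono) auto
        with p show "\<exists>p\<in>P. cutoff z (d p) 2 (\<lambda>x. dist x p) x = 1"
          by (intro bexI[of _ p]) (auto simp: cutoff_eq_1_iff[OF d(1)])
      qed
      from free_space_approx[OF UNIV_I this half_gt_zero[OF e]]
      obtain \<nu> where \<nu>: "\<nu> \<in> span (delta UNIV z ` UNIV)"
        "\<And>f. f \<in> Lip0 UNIV z \<Longrightarrow> \<bar>mulop UNIV z H \<theta> f - \<nu> f\<bar> \<le> e / 2 * Lip_const UNIV f" by blast
      have "\<bar>\<theta> f - \<nu> f\<bar> \<le> e * Lip_const UNIV f" if f: "f \<in> Lip0 UNIV z" for f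
      proof (rule abs_diff_le_trans[where c = "e / 2" and c' = "e / 2"])
        show "\<bar>\<theta> f - \<theta> (H * f)\<bar> \<le> e / 2 * Lip_const UNIV f"
          by (rule closure_bound[OF H(4)[OF _ f] \<theta>])
        show "\<bar>\<theta> (H * f) - \<nu> f\<bar> \<le> e / 2 * Lip_const UNIV f"
          using \<nu>(2)[OF f] f by (simp add: mulop_def)
      qed simp
      with \<nu>(1) show "\<exists>\<nu>\<in>span (delta UNIV z ` UNIV).
          \<forall>f\<in>Lip0 UNIV z. \<bar>\<theta> f - \<nu> f\<bar> \<le> e * Lip_const UNIV f" by blast
    qed (rule \<theta>f)
  qed
  then have "?V \<inter> closure \<Gamma> = closure \<Gamma>" by blast
  moreover have "compact (closure \<Gamma>)"
  proof (rule compact_closure_if_pointwise_bounded)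
    fix f
    show "\<exists>B. \<forall>\<mu>\<in>\<Gamma>. \<bar>\<mu> f\<bar> \<le> B"
    proof (cases "f \<in> Lip0 UNIV z")
      case True
      then show ?thesis using Vstar_set_pointwise_bounded[OF UNIV_I \<Gamma>] by metis
    next
      case False
      then have "\<forall>\<mu>\<in>\<Gamma>. \<bar>\<mu> f\<bar> \<le> 0" using functional by (simp add: Lip0_functional_def)
      then show ?thesis by blast
    qed
  qed
  ultimately show "compactin (weak_topology ?V (free_norm UNIV z))
      (weak_topology ?V (free_norm UNIV z) closure_of \<Gamma>)"
    by (simp add: weak_compactness_free_space[OF UNIV_I \<Gamma>V])
qed

end
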